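(* Up to a change of the parameters, any minimal Lorentzian surface in $\mathbb{R}^4_2$ whose first normal space is two-dimensional (at every point) has locally a Weierstrass type representation in isothermal parameters $$\Psi(u,v)=\beta(u+v)+\theta(u-v)$$ for some null curves $\beta$ and $\theta$ in $\mathbb{R}^4_2$ satisfying $$\beta'(t)=f_1(t)\big(1+g_1(t)h_1(t),\ g_1(t)-h_1(t),\ 1-g_1(t)h_1(t),\ g_1(t)+h_1(t)\big),$$ $$\theta'(s)=f_2(s)\big(1+g_2(s)h_2(s),\ g_2(s)-h_2(s),\ 1-g_2(s)h_2(s),\ g_2(s)+h_2(s)\big),$$ where $f_i,g_i,h_i$ ($i=1,2$) are smooth real functions of one real variable, and $\langle\beta'(t),\theta'(s)\rangle\neq 0$.
   Context: $\mathbb{R}^4_2$ is $\mathbb{R}^4$ with the flat metric $\langle X,Y\rangle=X_1Y_1+X_2Y_2-X_3Y_3-X_4Y_4$ of signature $(2,2)$. A Lorentzian surface is a smooth immersed surface whose induced metric is non-degenerate of signature $(1,1)$; it is minimal if its mean curvature vector vanishes identically. Parameters $(u,v)$ of $\Psi=\Psi(u,v)$ are isothermal if $E=\langle\Psi_u,\Psi_u\rangle$, $F=\langle\Psi_u,\Psi_v\rangle$, $G=\langle\Psi_v,\Psi_v\rangle$ satisfy $E=-G$, $F=0$. The first normal space at a point is the linear span in the normal plane of all values $\sigma(X,Y)$ of the second fundamental form (second fundamental tensor) $\sigma$. A null curve is a smooth curve $\beta$ whose tangent vector is null, i.e. $\beta'\neq 0$ and $\langle\beta',\beta'\rangle=0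$.
   Formalization: The stated form of β', θ' cannot represent null vectors with X₁+X₃=0, so the claim fails for some surfaces; it is proved as stated near points where both null tangent directions have X₁+X₃≠0, and elsewhere after a linear isometry of ℝ⁴₂. *)

theory Defs
  imports "HOL-Analysis.Analysis"
begin

section \<open>Smooth maps\<close>

text \<open>Meant for open \<open>S\<close>: all iterated directional derivatives up to order \<open>k\<close> exist (as Frechet
  derivatives) and are continuous.\<close>

fun Ck_on :: "nat \<Rightarrow> ('a::real_normed_vector \<Rightarrow> 'b::real_normed_vector) \<Rightarrow> 'a set \<Rightarrow> bool" where
  "Ck_on 0 f S \<longleftrightarrow> continuous_on S f"
| "Ck_on (Suc k) f S \<longleftrightarrow>
     (\<forall>x\<in>S. f differentiable (at x)) \<and> (\<forall>v. Ck_on k (\<lambda>x. frechet_derivative f (at x) v) S)"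

definition smooth_on :: "('a::real_normed_vector \<Rightarrow> 'b::real_normed_vector) \<Rightarrow> 'a set \<Rightarrow> bool" where
  "smooth_on f S \<longleftrightarrow> (\<forall>k. Ck_on k f S)"

definition change_of_parameters ::
    "(real \<times> real \<Rightarrow> real \<times> real) \<Rightarrow> (real \<times> real) set \<Rightarrow> (real \<times> real) set \<Rightarrow> bool" where
  "change_of_parameters \<phi> W V \<longleftrightarrow>
     open W \<and> open V \<and> bij_betw \<phi> W V \<and> smooth_on \<phi> W \<and> smooth_on (inv_into W \<phi>) V"


section \<open>The space with the flat metric of signature (2,2)\<close>

definition inner22 :: "real^4 \<Rightarrow> real^4 \<Rightarrow> real" where
  "inner22 X Y = X$1 * Y$1 + X$2 * Y$2 - X$3 * Y$3 - X$4 * Y$4"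

definition linear_isometry22 :: "(real^4 \<Rightarrow> real^4) \<Rightarrow> bool" where
  "linear_isometry22 A \<longleftrightarrow> linear A \<and> (\<forall>X Y. inner22 (A X) (A Y) = inner22 X Y)"

definition signature_1_1 :: "(real^4) set \<Rightarrow> bool" where
  "signature_1_1 T \<longleftrightarrow>
     (\<exists>X Y. T = span {X, Y} \<and> inner22 X X = 1 \<and> inner22 Y Y = -1 \<and> inner22 X Y = 0)"


section \<open>Parametrized surfaces\<close>

definition tangent_space :: "(real \<times> real \<Rightarrow> real^4) \<Rightarrow> real \<times> real \<Rightarrow> (real^4) set" where
  "tangent_space \<Psi> p = range (frechet_derivative \<Psi> (at p))"

definition normal_space :: "(real \<times> real \<Rightarrow> real^4) \<Rightarrow> real \<times> real \<Rightarrow> (real^4) set" where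
  "normal_space \<Psi> p = {N. \<forall>X\<in>tangent_space \<Psi> p. inner22 N X = 0}"

definition normal_component ::
    "(real \<times> real \<Rightarrow> real^4) \<Rightarrow> real \<times> real \<Rightarrow> real^4 \<Rightarrow> real^4" where
  "normal_component \<Psi> p Z = (THE N. N \<in> normal_space \<Psi> p \<and> Z - N \<in> tangent_space \<Psi> p)"

definition lorentzian_surface :: "(real \<times> real \<Rightarrow> real^4) \<Rightarrow> (real \<times> real) set \<Rightarrow> bool" where
  "lorentzian_surface \<Psi> U \<longleftrightarrow>
     open U \<and> smooth_on \<Psi> U \<and>
     (\<forall>p\<in>U. inj (frechet_derivative \<Psi> (at p)) \<and> signature_1_1 (tangent_space \<Psi> p))"

lemma normal_component_ex1:
  assumes "signature_1_1 (tangent_space \<Psi> p)"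
  shows "\<exists>!N. N \<in> normal_space \<Psi> p \<and> Z - N \<in> tangent_space \<Psi> p"
proof -
  obtain X Y where T: "tangent_space \<Psi> p = span {X, Y}"
    and XX: "inner22 X X = 1" and YY: "inner22 Y Y = -1" and XY: "inner22 X Y = 0"
    using assms by (auto simp: signature_1_1_def)
  have YX: "inner22 Y X = 0" using XY by (simp add: inner22_def algebra_simps)
  have lin: "inner22 (a - b) c = inner22 a c - inner22 b c"
    "inner22 (a + b) c = inner22 a c + inner22 b c"
    "inner22 c (a + b) = inner22 c a + inner22 c b"
    "inner22 (r *\<^sub>R a) c = r * inner22 a c" "inner22 c (r *\<^sub>R a) = r * inner22 c a" for a b c r
    by (simp_all add: inner22_def algebra_simps)
  have mem: "V \<in> span {X, Y} \<longleftrightarrow> (\<exists>a b. V = a *\<^sub>R X + b *\<^sub>R Y)" for V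
    by (auto simp: span_insert span_singleton algebra_simps)
  have normal: "N \<in> normal_space \<Psi> p \<longleftrightarrow> inner22 N X = 0 \<and> inner22 N Y = 0" for N
  proof
    assume "N \<in> normal_space \<Psi> p"
    then show "inner22 N X = 0 \<and> inner22 N Y = 0"
      by (simp add: normal_space_def T span_base)
  next
    assume "inner22 N X = 0 \<and> inner22 N Y = 0"
    then show "N \<in> normal_space \<Psi> p"
      by (auto simp: normal_space_def T mem lin)
  qed
  show ?thesis
  proof (rule ex1I)
    let ?N = "Z - (inner22 Z X *\<^sub>R X + (- inner22 Z Y) *\<^sub>R Y)"
    have "Z - ?N \<in> tangent_space \<Psi> p"
      unfolding T mem
      by (intro exI[of _ "inner22 Z X"] exI[of _ "- inner22 Z Y"]) simp
    moreover have "?N \<in> normal_space \<Psi> p"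
      by (simp only: normal lin) (simp add: XX YY XY YX)
    ultimately show "?N \<in> normal_space \<Psi> p \<and> Z - ?N \<in> tangent_space \<Psi> p" by blast
  next
    fix N assume N: "N \<in> normal_space \<Psi> p \<and> Z - N \<in> tangent_space \<Psi> p"
    then obtain a b where ab: "Z - N = a *\<^sub>R X + b *\<^sub>R Y" by (auto simp: T mem)
    have "inner22 (Z - N) X = a" "inner22 (Z - N) Y = - b"
      by (simp_all add: ab lin XX YY XY YX)
    then have "a = inner22 Z X" "b = - inner22 Z Y"
      using N by (simp_all add: normal lin)
    then show "N = Z - (inner22 Z X *\<^sub>R X + (- inner22 Z Y) *\<^sub>R Y)"
      using ab by (simp add: algebra_simps)
  qed
qed

text \<open>The second fundamental form is pulled back to the parameter plane: \<open>a\<close> and \<open>b\<close> stand for the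
  tangent vectors \<open>d\<Psi>\<^sub>p(a)\<close> and \<open>d\<Psi>\<^sub>p(b)\<close>, and the flat covariant derivative is the second
  directional derivative of \<open>\<Psi>\<close>.\<close>

definition second_fundamental_form ::
    "(real \<times> real \<Rightarrow> real^4) \<Rightarrow> real \<times> real \<Rightarrow> real \<times> real \<Rightarrow> real \<times> real \<Rightarrow> real^4" where
  "second_fundamental_form \<Psi> p a b =
     normal_component \<Psi> p (frechet_derivative (\<lambda>q. frechet_derivative \<Psi> (at q) b) (at p) a)"

definition first_normal_space :: "(real \<times> real \<Rightarrow> real^4) \<Rightarrow> real \<times> real \<Rightarrow> (real^4) set" where
  "first_normal_space \<Psi> p = span {second_fundamental_form \<Psi> p a b | a b. True}"

definition coeff_E :: "(real \<times> real \<Rightarrow> real^4) \<Rightarrow> real \<times> real \<Rightarrow> real" where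
  "coeff_E \<Psi> p = inner22 (frechet_derivative \<Psi> (at p) (1, 0)) (frechet_derivative \<Psi> (at p) (1, 0))"

definition coeff_F :: "(real \<times> real \<Rightarrow> real^4) \<Rightarrow> real \<times> real \<Rightarrow> real" where
  "coeff_F \<Psi> p = inner22 (frechet_derivative \<Psi> (at p) (1, 0)) (frechet_derivative \<Psi> (at p) (0, 1))"

definition coeff_G :: "(real \<times> real \<Rightarrow> real^4) \<Rightarrow> real \<times> real \<Rightarrow> real" where
  "coeff_G \<Psi> p = inner22 (frechet_derivative \<Psi> (at p) (0, 1)) (frechet_derivative \<Psi> (at p) (0, 1))"

definition isothermal_on :: "(real \<times> real \<Rightarrow> real^4) \<Rightarrow> (real \<times> real) set \<Rightarrow> bool" where
  "isothermal_on \<Psi> W \<longleftrightarrow> (\<forall>p\<in>W. coeff_E \<Psi> p = - coeff_G \<Psi> p \<and> coeff_F \<Psi> p = 0)"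

text \<open>Half the trace of the second fundamental form with respect to the induced metric, written with
  the inverse of the matrix \<open>(E, F; F, G)\<close>.\<close>

definition mean_curvature_vector :: "(real \<times> real \<Rightarrow> real^4) \<Rightarrow> real \<times> real \<Rightarrow> real^4" where
  "mean_curvature_vector \<Psi> p =
     (1 / (2 * (coeff_E \<Psi> p * coeff_G \<Psi> p - (coeff_F \<Psi> p)\<^sup>2))) *\<^sub>R
       (coeff_G \<Psi> p *\<^sub>R second_fundamental_form \<Psi> p (1, 0) (1, 0)
        - (2 * coeff_F \<Psi> p) *\<^sub>R second_fundamental_form \<Psi> p (1, 0) (0, 1)
        + coeff_E \<Psi> p *\<^sub>R second_fundamental_form \<Psi> p (0, 1) (0, 1))"

definition minimal_lorentzian_surface :: "(real \<times> real \<Rightarrow> real^4) \<Rightarrow> (real \<times> real) set \<Rightarrow> bool" where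
  "minimal_lorentzian_surface \<Psi> U \<longleftrightarrow>
     lorentzian_surface \<Psi> U \<and> (\<forall>p\<in>U. mean_curvature_vector \<Psi> p = 0)"


section \<open>Null curves and the Weierstrass type representation\<close>

definition null_curve :: "(real \<Rightarrow> real^4) \<Rightarrow> real set \<Rightarrow> bool" where
  "null_curve \<beta> I \<longleftrightarrow>
     open I \<and> is_interval I \<and> smooth_on \<beta> I \<and>
     (\<forall>t\<in>I. vector_derivative \<beta> (at t) \<noteq> 0 \<and>
       inner22 (vector_derivative \<beta> (at t)) (vector_derivative \<beta> (at t)) = 0)"

definition weierstrass_vector :: "real \<Rightarrow> real \<Rightarrow> real \<Rightarrow> real^4" where
  "weierstrass_vector f g h = f *\<^sub>R vector [1 + g * h, g - h, 1 - g * h, g + h]"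

lemma weierstrass_vector_nth:
  "weierstrass_vector f g h $ 1 = f * (1 + g * h)"
  "weierstrass_vector f g h $ 2 = f * (g - h)"
  "weierstrass_vector f g h $ 3 = f * (1 - g * h)"
  "weierstrass_vector f g h $ 4 = f * (g + h)"
  by (simp_all add: weierstrass_vector_def vector_def)

definition weierstrass_null_curve :: "(real \<Rightarrow> real^4) \<Rightarrow> real set \<Rightarrow> bool" where
  "weierstrass_null_curve \<beta> I \<longleftrightarrow>
     null_curve \<beta> I \<and>
     (\<exists>f g h :: real \<Rightarrow> real. smooth_on f I \<and> smooth_on g I \<and> smooth_on h I \<and>
       (\<forall>t\<in>I. vector_derivative \<beta> (at t) = weierstrass_vector (f t) (g t) (h t)))"

definition weierstrass_representation_near ::
    "(real \<times> real \<Rightarrow> real^4) \<Rightarrow> (real \<times> real) set \<Rightarrow> real \<times> real \<Rightarrow> bool" where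
  "weierstrass_representation_near \<Psi> U p \<longleftrightarrow>
     (\<exists>V \<phi> I J \<beta> \<theta>. let W = {(u, v). u + v \<in> I \<and> u - v \<in> J} in
        p \<in> V \<and> V \<subseteq> U \<and> change_of_parameters \<phi> W V \<and> isothermal_on (\<Psi> \<circ> \<phi>) W \<and>
        weierstrass_null_curve \<beta> I \<and> weierstrass_null_curve \<theta> J \<and>
        (\<forall>t\<in>I. \<forall>s\<in>J. inner22 (vector_derivative \<beta> (at t)) (vector_derivative \<theta> (at s)) \<noteq> 0) \<and>
        (\<forall>(u, v)\<in>W. (\<Psi> \<circ> \<phi>) (u, v) = \<beta> (u + v) + \<theta> (u - v)))"

text \<open>The first and third coordinates of \<open>weierstrass_vector f g h\<close> add up to \<open>2 f\<close>, so it represents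
  exactly those null vectors \<open>X \<noteq> 0\<close> with \<open>X$1 + X$3 \<noteq> 0\<close>. As the two null tangent directions of
  the surface are spanned by \<open>\<beta>'\<close> and \<open>\<theta>'\<close>, the following condition is necessary for a
  representation of \<open>\<Psi>\<close> near \<open>p\<close> in the given coordinates of the ambient space. Minimal Lorentzian
  surfaces with two-dimensional first normal space can violate it at every point, e.g. for
  \<open>\<beta>'(t) = (cos t, sin t, - cos t, sin t)\<close> and \<open>\<theta>'(s) = (1, - s, 1, s)\<close> near \<open>t = s = 0\<close>; the
  coordinate system of the ambient space then has to be changed by an isometry first.\<close>

definition null_directions_representable ::
    "(real \<times> real \<Rightarrow> real^4) \<Rightarrow> real \<times> real \<Rightarrow> bool" where
  "null_directions_representable \<Psi> p \<longleftrightarrow>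
     (\<forall>X\<in>tangent_space \<Psi> p. X \<noteq> 0 \<and> inner22 X X = 0 \<longrightarrow> X$1 + X$3 \<noteq> 0)"

end

theory Submission
  imports Defs
begin

text \<open>A surface is minimal iff its coordinate functions are harmonic for the induced metric, that is, iff
  the \<open>\<real>\<^sup>4\<close>-valued form \<open>* d\<Psi>\<close> is closed. In Lorentzian signature the Hodge star on one-forms of a
  surface satisfies \<open>** = 1\<close>. Hence if \<open>* d\<Psi> = d\<Phi>\<close> near a point, then
  \<open>\<Psi> = \<beta> + \<theta>\<close> with \<open>\<beta> = (\<Psi> + \<Phi>) / 2\<close> and \<open>\<theta> = (\<Psi> - \<Phi>) / 2\<close>, and
  \<open>d\<beta>\<close> and \<open>d\<theta>\<close> are the parts of \<open>d\<Psi>\<close> in the two eigenspaces of the star: at each point the image of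
  either one is a null line of the tangent plane (\<open>minimal_imp_conjugate_closed\<close>,
  \<open>minimal_surface_splits\<close>). So each of \<open>\<beta>\<close> and \<open>\<theta>\<close> sweeps out a null curve.

  Null coordinates come from the same functions. Let \<open>\<kappa>\<close> be a linear functional on the ambient space
  that vanishes on neither null line. Then \<open>x = \<kappa> \<circ> \<beta>\<close> and \<open>y = \<kappa> \<circ> \<theta>\<close> are local
  coordinates by the inverse function theorem, and \<open>\<beta>\<close> depends only on \<open>x\<close>, because \<open>dx = 0\<close> forces
  \<open>d\<beta> = 0\<close>, and likewise \<open>\<theta>\<close> depends only on \<open>y\<close> (\<open>null_coordinates\<close>). This avoids integrating the null
  directions as an ordinary differential equation. With \<open>x = u + v\<close> and \<open>y = u - v\<close> the parameters
  \<open>(u, v)\<close> are isothermal.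

  With the functional \<open>\<kappa>(X) = X\<^sub>1 + X\<^sub>3\<close> the curves are moreover normalized by \<open>\<beta>'\<^sub>1 + \<beta>'\<^sub>3 = 1\<close>, and
  the null condition becomes the Weierstrass formula with \<open>f = 1/2\<close>
  (\<open>weierstrass_null_curve_of_normalized\<close>). This functional is admissible exactly if the null directions
  at the point are representable; otherwise \<open>\<kappa>\<close> is composed with an isometry, a rotation in the first
  two coordinates, that moves both null lines off its kernel
  (\<open>ex_isometry_null_directions_representable\<close>).\<close>


section \<open>Smooth maps\<close>

lemma frechet_derivative_eqI:
  "(f has_derivative f') (at x) \<Longrightarrow> frechet_derivative f (at x) = f'"
  by (metis frechet_derivative_at)

lemma Ck_on_cong:
  assumes "open S" and "\<And>x. x \<in> S \<Longrightarrow> f x = g x" and "Ck_on k f S"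
  shows "Ck_on k g S"
  using assms(2,3)
proof (induction k arbitrary: f g)
  case 0
  then show ?case by (simp cong: continuous_on_cong)
next
  case (Suc k)
  have der: "(g has_derivative frechet_derivative f (at x)) (at x)" if "x \<in> S" for x
  proof (rule has_derivative_transform_within_open[OF _ \<open>open S\<close> that])
    show "(f has_derivative frechet_derivative f (at x)) (at x)"
      using Suc.prems(2) that by (simp add: frechet_derivative_works)
  qed (use Suc.prems in auto)
  have "Ck_on k (\<lambda>x. frechet_derivative g (at x) v) S" for v
    by (rule Suc.IH[where f = "\<lambda>x. frechet_derivative f (at x) v"])
      (use Suc.prems(2) in \<open>simp_all add: frechet_derivative_eqI[OF der]\<close>)
  then show ?case using der by (auto simp: differentiable_def)
qed

lemma Ck_on_SucI:
  assumes "open S" and "\<And>x. x \<in> S \<Longrightarrow> (f has_derivative f' x) (at x)"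
    and "\<And>v. Ck_on k (\<lambda>x. f' x v) S"
  shows "Ck_on (Suc k) f S"
  using assms Ck_on_cong[OF assms(1) _ assms(3)]
  by (auto simp: differentiable_def frechet_derivative_eqI[OF assms(2)])

lemma Ck_on_SucD:
  assumes "Ck_on (Suc k) f S"
  shows "x \<in> S \<Longrightarrow> (f has_derivative frechet_derivative f (at x)) (at x)"
    and "Ck_on k (\<lambda>x. frechet_derivative f (at x) v) S"
  using assms by (simp_all add: frechet_derivative_works)

lemma Ck_on_pred: "Ck_on (Suc k) f S \<Longrightarrow> Ck_on k f S"
proof (induction k arbitrary: f)
  case 0
  then have "isCont f x" if "x \<in> S" for x
    using that by (simp add: differentiable_imp_continuous_within)
  then show ?case by (simp add: continuous_at_imp_continuous_on)
next
  case (Suc k)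
  from Suc.prems Suc.IH show ?case
    unfolding Ck_on.simps(2)[of "Suc k" f S] Ck_on.simps(2)[of k f S] by blast
qed

lemma Ck_on_subset: "Ck_on k f S \<Longrightarrow> T \<subseteq> S \<Longrightarrow> Ck_on k f T"
  by (induction k arbitrary: f) (auto intro: continuous_on_subset)

lemma Ck_on_const: "Ck_on k (\<lambda>x. c) S"
  by (induction k arbitrary: c) auto

lemma Ck_on_bounded_linear:
  assumes "open S" and "bounded_linear L" and "Ck_on k f S"
  shows "Ck_on k (\<lambda>x. L (f x)) S"
  using assms(3)
proof (induction k arbitrary: f)
  case 0
  then show ?case using assms(2) by (simp add: bounded_linear.continuous_on)
next
  case (Suc k)
  show ?case
    by (rule Ck_on_SucI[OF assms(1) bounded_linear.has_derivative[OF assms(2) Ck_on_SucD(1)[OF Suc.prems]]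
          Suc.IH[OF Ck_on_SucD(2)[OF Suc.prems]]])
qed

lemma Ck_on_id: "open S \<Longrightarrow> Ck_on k (\<lambda>x. x) S"
  by (cases k) (simp_all add: Ck_on_const)

lemma Ck_on_add:
  assumes "open S" and "Ck_on k f S" and "Ck_on k g S"
  shows "Ck_on k (\<lambda>x. f x + g x) S"
  using assms(2,3)
proof (induction k arbitrary: f g)
  case 0
  then show ?case by (simp add: continuous_on_add)
next
  case (Suc k)
  show ?case
    by (rule Ck_on_SucI[OF assms(1) has_derivative_add[OF Ck_on_SucD(1)[OF Suc.prems(1)]
            Ck_on_SucD(1)[OF Suc.prems(2)]]])
      (auto intro!: Suc.IH Ck_on_SucD(2)[OF Suc.prems(1)] Ck_on_SucD(2)[OF Suc.prems(2)])
qed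

lemma Ck_on_sum:
  assumes "open S" and "finite I" and "\<And>i. i \<in> I \<Longrightarrow> Ck_on k (f i) S"
  shows "Ck_on k (\<lambda>x. \<Sum>i\<in>I. f i x) S"
  using assms(2,3) by (induction I) (auto intro!: Ck_on_add Ck_on_const assms(1))

lemma Ck_on_bounded_bilinear:
  assumes "open S" and "bounded_bilinear B" and "Ck_on k f S" and "Ck_on k g S"
  shows "Ck_on k (\<lambda>x. B (f x) (g x)) S"
  using assms(3,4)
proof (induction k arbitrary: f g)
  case 0
  then show ?case using assms(2) by (simp add: bounded_bilinear.continuous_on)
next
  case (Suc k)
  show ?case
    by (rule Ck_on_SucI[OF assms(1) bounded_bilinear.FDERIV[OF assms(2)
            Ck_on_SucD(1)[OF Suc.prems(1)] Ck_on_SucD(1)[OF Suc.prems(2)]]])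
      (auto intro!: Ck_on_add assms(1) Suc.IH Ck_on_pred[OF Suc.prems(1)] Ck_on_pred[OF Suc.prems(2)]
         Ck_on_SucD(2)[OF Suc.prems(1)] Ck_on_SucD(2)[OF Suc.prems(2)])
qed

text \<open>By the chain rule the derivative of \<open>f \<circ> g\<close> in direction \<open>v\<close> is a sum, over a basis of the middle
  space, of products of first derivatives of \<open>g\<close> with first derivatives of \<open>f\<close> along \<open>g\<close>; the latter are
  compositions again, so that induction on the order applies.\<close>

lemma Ck_on_compose:
  fixes g :: "'a::real_normed_vector \<Rightarrow> 'b::euclidean_space"
  assumes "open S" and "Ck_on k f T" and "Ck_on k g S" and "g ` S \<subseteq> T"
  shows "Ck_on k (\<lambda>x. f (g x)) S"
  using assms(2,3)
proof (induction k arbitrary: f)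
  case 0
  then show ?case using assms(4) by (auto intro: continuous_on_compose2)
next
  case (Suc k)
  let ?f' = "\<lambda>y. frechet_derivative f (at y)" and ?g' = "\<lambda>x. frechet_derivative g (at x)"
  show ?case
  proof (rule Ck_on_SucI[OF assms(1), where f' = "\<lambda>x v. \<Sum>b\<in>Basis. (?g' x v \<bullet> b) *\<^sub>R ?f' (g x) b"])
    fix x assume x: "x \<in> S"
    then have "g x \<in> T" using assms(4) by auto
    then have f: "(f has_derivative ?f' (g x)) (at (g x))"
      by (rule Ck_on_SucD(1)[OF Suc.prems(1)])
    have expand: "?f' (g x) w = (\<Sum>b\<in>Basis. (w \<bullet> b) *\<^sub>R ?f' (g x) b)" for w
    proof -
      have lin: "linear (?f' (g x))" using f by (rule has_derivative_linear)
      have "?f' (g x) w = ?f' (g x) (\<Sum>b\<in>Basis. (w \<bullet> b) *\<^sub>R b)"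
        by (simp add: euclidean_representation)
      then show ?thesis by (simp add: linear_sum[OF lin] linear_cmul[OF lin])
    qed
    show "((\<lambda>x. f (g x)) has_derivative
        (\<lambda>v. \<Sum>b\<in>Basis. (?g' x v \<bullet> b) *\<^sub>R ?f' (g x) b)) (at x)"
      by (rule has_derivative_eq_rhs[OF has_derivative_compose[OF Ck_on_SucD(1)[OF Suc.prems(2) x] f]])
        (rule ext, rule expand)
  next
    fix v
    show "Ck_on k (\<lambda>x. \<Sum>b\<in>Basis. (?g' x v \<bullet> b) *\<^sub>R ?f' (g x) b) S"
      by (intro Ck_on_sum Ck_on_bounded_bilinear[OF _ bounded_bilinear_scaleR]
          Ck_on_bounded_linear[OF _ bounded_linear_inner_left] Suc.IH Ck_on_pred[OF Suc.prems(2)]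
          Ck_on_SucD(2)[OF Suc.prems(1)] Ck_on_SucD(2)[OF Suc.prems(2)] assms(1) finite_Basis)
  qed
qed

lemma Ck_on_inverse: "Ck_on k (inverse :: real \<Rightarrow> real) (- {0})"
proof (induction k)
  case 0
  then show ?case by (auto intro!: continuous_intros)
next
  case (Suc k)
  show ?case
    by (rule Ck_on_SucI[where f' = "\<lambda>x v. - (inverse x * v * inverse x)"])
      (auto intro!: has_derivative_inverse' Suc Ck_on_const
        Ck_on_bounded_bilinear[OF _ bounded_bilinear_mult]
        Ck_on_bounded_linear[OF _ bounded_linear_minus[OF bounded_linear_ident]])
qed

lemma Ck_on_sqrt: "Ck_on k sqrt {0<..}"
proof (induction k)
  case 0
  then show ?case by (auto intro!: continuous_intros)
next
  case (Suc k)
  show ?case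
  proof (rule Ck_on_SucI[where f' = "\<lambda>x v. v * (inverse (sqrt x) / 2)"])
    fix x :: real assume "x \<in> {0<..}"
    then have "(sqrt has_real_derivative inverse (sqrt x) / 2) (at x)" by (auto intro: DERIV_real_sqrt)
    then show "(sqrt has_derivative (\<lambda>v. v * (inverse (sqrt x) / 2))) (at x)"
      unfolding has_field_derivative_def by (rule has_derivative_eq_rhs) (simp add: fun_eq_iff mult.commute)
  next
    fix v
    show "Ck_on k (\<lambda>x. v * (inverse (sqrt x) / 2)) {0<..}"
      by (intro Ck_on_bounded_linear[OF _ bounded_linear_mult_right]
          Ck_on_bounded_linear[OF _ bounded_linear_divide] Ck_on_compose[OF _ Ck_on_inverse Suc]) auto
  qed simp
qed

lemma smooth_onI: "(\<And>k. Ck_on k f S) \<Longrightarrow> smooth_on f S"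
  by (simp add: smooth_on_def)

lemma smooth_onD: "smooth_on f S \<Longrightarrow> Ck_on k f S"
  by (simp add: smooth_on_def)

lemma smooth_on_has_derivative:
  assumes "smooth_on f S" and "x \<in> S"
  shows "(f has_derivative frechet_derivative f (at x)) (at x)"
  by (rule Ck_on_SucD(1)[OF smooth_onD[OF assms(1)] assms(2)])

lemma smooth_on_continuous_on:
  assumes "smooth_on f S"
  shows "continuous_on S f"
  using smooth_onD[OF assms, of 0] by simp

lemma smooth_on_frechet_derivative:
  assumes "smooth_on f S"
  shows "smooth_on (\<lambda>x. frechet_derivative f (at x) v) S"
  by (rule smooth_onI, rule Ck_on_SucD(2)[OF smooth_onD[OF assms]])

lemma smooth_on_cong:
  assumes "open S" and "\<And>x. x \<in> S \<Longrightarrow> f x = g x" and "smooth_on f S"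
  shows "smooth_on g S"
  by (rule smooth_onI, rule Ck_on_cong[OF assms(1,2) smooth_onD[OF assms(3)]])

lemma smooth_on_subset:
  assumes "smooth_on f S" and "T \<subseteq> S"
  shows "smooth_on f T"
  by (rule smooth_onI, rule Ck_on_subset[OF smooth_onD[OF assms(1)] assms(2)])

lemma smooth_on_from_derivative:
  assumes "open S" and "\<And>x. x \<in> S \<Longrightarrow> (f has_derivative f' x) (at x)"
    and "\<And>v. smooth_on (\<lambda>x. f' x v) S"
  shows "smooth_on f S"
  by (rule smooth_onI, rule Ck_on_pred, rule Ck_on_SucI[OF assms(1,2) smooth_onD[OF assms(3)]])

lemma smooth_on_const: "smooth_on (\<lambda>x. c) S"
  by (rule smooth_onI, rule Ck_on_const)

lemma smooth_on_id: "open S \<Longrightarrow> smooth_on (\<lambda>x. x) S"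
  by (rule smooth_onI, rule Ck_on_id)

lemma smooth_on_bounded_linear:
  assumes "bounded_linear L" and "open S" and "smooth_on f S"
  shows "smooth_on (\<lambda>x. L (f x)) S"
  by (rule smooth_onI, rule Ck_on_bounded_linear[OF assms(2,1) smooth_onD[OF assms(3)]])

lemma smooth_on_bounded_bilinear:
  assumes "bounded_bilinear B" and "open S" and "smooth_on f S" and "smooth_on g S"
  shows "smooth_on (\<lambda>x. B (f x) (g x)) S"
  by (rule smooth_onI)
    (rule Ck_on_bounded_bilinear[OF assms(2,1) smooth_onD[OF assms(3)] smooth_onD[OF assms(4)]])

lemma smooth_on_add:
  assumes "open S" and "smooth_on f S" and "smooth_on g S"
  shows "smooth_on (\<lambda>x. f x + g x) S"
  by (rule smooth_onI, rule Ck_on_add[OF assms(1) smooth_onD[OF assms(2)] smooth_onD[OF assms(3)]])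

lemma smooth_on_diff:
  assumes "open S" and "smooth_on f S" and "smooth_on g S"
  shows "smooth_on (\<lambda>x. f x - g x) S"
  using smooth_on_add[OF assms(1,2) smooth_on_bounded_linear[OF
        bounded_linear_minus[OF bounded_linear_ident] assms(1,3)]] by simp

lemma smooth_on_compose:
  fixes g :: "'a::real_normed_vector \<Rightarrow> 'b::euclidean_space"
  assumes "open S" and "smooth_on f T" and "smooth_on g S" and "g ` S \<subseteq> T"
  shows "smooth_on (\<lambda>x. f (g x)) S"
  by (rule smooth_onI)
    (rule Ck_on_compose[OF assms(1) smooth_onD[OF assms(2)] smooth_onD[OF assms(3)] assms(4)])

lemmas smooth_on_scaleR = smooth_on_bounded_bilinear[OF bounded_bilinear_scaleR]
lemmas smooth_on_mult = smooth_on_bounded_bilinear[OF bounded_bilinear_mult]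

lemma smooth_on_divide:
  fixes f g :: "'a::real_normed_vector \<Rightarrow> real"
  assumes "open S" and "smooth_on f S" and "smooth_on g S" and "\<And>x. x \<in> S \<Longrightarrow> g x \<noteq> 0"
  shows "smooth_on (\<lambda>x. f x / g x) S"
proof -
  have "g ` S \<subseteq> - {0}" using assms(4) by auto
  then have "smooth_on (\<lambda>x. inverse (g x)) S"
    by (rule smooth_on_compose[OF assms(1) smooth_onI[OF Ck_on_inverse] assms(3)])
  from smooth_on_mult[OF assms(1,2) this] show ?thesis by (simp add: divide_inverse)
qed

lemma smooth_on_sqrt:
  fixes f :: "'a::real_normed_vector \<Rightarrow> real"
  assumes "open S" and "smooth_on f S" and "\<And>x. x \<in> S \<Longrightarrow> 0 < f x"
  shows "smooth_on (\<lambda>x. sqrt (f x)) S"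
proof -
  have "f ` S \<subseteq> {0<..}" using assms(3) by auto
  then show ?thesis by (rule smooth_on_compose[OF assms(1) smooth_onI[OF Ck_on_sqrt] assms(2)])
qed

lemma smooth_on_Pair:
  assumes "open S" and "smooth_on f S" and "smooth_on g S"
  shows "smooth_on (\<lambda>x. (f x, g x)) S"
  using smooth_on_add[OF assms(1)
      smooth_on_bounded_linear[OF bounded_linear_Pair[OF bounded_linear_ident bounded_linear_zero] assms(1,2)]
      smooth_on_bounded_linear[OF bounded_linear_Pair[OF bounded_linear_zero bounded_linear_ident] assms(1,3)]]
  by simp

lemma frechet_derivative_cong_open:
  assumes "open U" and "smooth_on f U" and "p \<in> U" and "\<And>q. q \<in> U \<Longrightarrow> f q = g q"
  shows "frechet_derivative f (at p) = frechet_derivative g (at p)"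
  using frechet_derivative_eqI[OF has_derivative_transform_within_open[OF
        smooth_on_has_derivative[OF assms(2,3)] assms(1,3,4)]] by simp

lemma frechet_derivative_bounded_bilinear:
  assumes "bounded_bilinear B" and "smooth_on f U" and "smooth_on g U" and "p \<in> U"
  shows "frechet_derivative (\<lambda>q. B (f q) (g q)) (at p) v =
    B (f p) (frechet_derivative g (at p) v) + B (frechet_derivative f (at p) v) (g p)"
  by (rule fun_cong[OF frechet_derivative_eqI[OF bounded_bilinear.FDERIV[OF assms(1)
            smooth_on_has_derivative[OF assms(2,4)] smooth_on_has_derivative[OF assms(3,4)]]]])

lemma frechet_derivative_minus_smooth:
  assumes "smooth_on f U" and "smooth_on g U" and "p \<in> U"
  shows "frechet_derivative (\<lambda>q. f q - g q) (at p) v =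
    frechet_derivative f (at p) v - frechet_derivative g (at p) v"
  by (rule fun_cong[OF frechet_derivative_eqI[OF has_derivative_diff[OF
            smooth_on_has_derivative[OF assms(1,3)] smooth_on_has_derivative[OF assms(2,3)]]]])


section \<open>Calculus in the plane\<close>

lemma linear_plane:
  fixes L :: "real \<times> real \<Rightarrow> 'b::real_vector"
  assumes "linear L"
  shows "L (x, y) = x *\<^sub>R L (1, 0) + y *\<^sub>R L (0, 1)"
proof -
  have "(x, y) = x *\<^sub>R (1, 0) + y *\<^sub>R (0, 1)" by simp
  then show ?thesis by (metis assms linear_add linear_cmul)
qed

lemma has_vector_derivative_fst:
  fixes f :: "real \<times> real \<Rightarrow> 'b::real_normed_vector"
  assumes "(f has_derivative f') (at (u, v))"
  shows "((\<lambda>x. f (x, v)) has_vector_derivative f' (1, 0)) (at u within X)"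
proof -
  have "((\<lambda>x. (x, v)) has_derivative (\<lambda>h. (h, 0))) (at u within X)"
    by (auto intro!: derivative_eq_intros)
  note der = has_derivative_compose[OF this assms]
  show ?thesis
    unfolding has_vector_derivative_def
    by (rule has_derivative_eq_rhs[OF der], rule ext,
        rule trans[OF linear_plane[OF has_derivative_linear[OF assms]]]) simp
qed

lemma has_vector_derivative_snd:
  fixes f :: "real \<times> real \<Rightarrow> 'b::real_normed_vector"
  assumes "(f has_derivative f') (at (u, v))"
  shows "((\<lambda>y. f (u, y)) has_vector_derivative f' (0, 1)) (at v within X)"
proof -
  have "((\<lambda>y. (u, y)) has_derivative (\<lambda>h. (0, h))) (at v within X)"
    by (auto intro!: derivative_eq_intros)
  note der = has_derivative_compose[OF this assms]
  show ?thesis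
    unfolding has_vector_derivative_def
    by (rule has_derivative_eq_rhs[OF der], rule ext,
        rule trans[OF linear_plane[OF has_derivative_linear[OF assms]]]) simp
qed

lemma open_rectangle_in:
  assumes "open U" and "(u, v) \<in> U"
  obtains a b c d :: real where "a < u" "u < b" "c < v" "v < d" "{a..b} \<times> {c..d} \<subseteq> U"
proof -
  obtain A B where AB: "open A" "open B" "u \<in> A" "v \<in> B" "A \<times> B \<subseteq> U"
    using assms by (metis mem_Sigma_iff open_prod_elim)
  obtain r where r: "0 < r" "cball u r \<subseteq> A"
    using \<open>open A\<close> \<open>u \<in> A\<close> unfolding open_contains_cball by blast
  obtain s where s: "0 < s" "cball v s \<subseteq> B"
    using \<open>open B\<close> \<open>v \<in> B\<close> unfolding open_contains_cball by blast
  have "{u - r..u + r} \<times> {v - s..v + s} \<subseteq> U"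
    using AB(5) r(2) s(2) unfolding cball_eq_atLeastAtMost by blast
  then show thesis
    using r(1) s(1) by (intro that[of "u - r" "u + r" "v - s" "v + s"]) auto
qed

lemma continuous_on_vertical:
  fixes f :: "real \<times> real \<Rightarrow> 'b::euclidean_space"
  assumes "smooth_on f U" and "{a..b} \<times> {c..d} \<subseteq> U" and "x \<in> {a..b}"
  shows "continuous_on {c..d} (\<lambda>t. f (x, t))"
  by (rule continuous_on_compose2[OF smooth_on_continuous_on[OF assms(1)]])
    (use assms(2,3) in \<open>auto intro!: continuous_intros\<close>)

lemma has_vector_derivative_vertical_integral:
  fixes f :: "real \<times> real \<Rightarrow> 'b::euclidean_space"
  assumes "smooth_on f U" and "{a..b} \<times> {c..d} \<subseteq> U" and "u \<in> {a..b}"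
  shows "((\<lambda>x. integral {c..d} (\<lambda>t. f (x, t))) has_vector_derivative
      integral {c..d} (\<lambda>t. frechet_derivative f (at (u, t)) (1, 0))) (at u within {a..b})"
  unfolding interval_cbox
proof (rule leibniz_rule_vector_derivative)
  fix x t :: real
  assume "x \<in> cbox a b" "t \<in> cbox c d"
  then have "(x, t) \<in> U" using assms(2) by auto
  then show "((\<lambda>x. f (x, t)) has_vector_derivative frechet_derivative f (at (x, t)) (1, 0))
      (at x within cbox a b)"
    by (intro has_vector_derivative_fst smooth_on_has_derivative[OF assms(1)])
next
  fix x
  assume "x \<in> cbox a b"
  then show "(\<lambda>t. f (x, t)) integrable_on cbox c d"
    using continuous_on_vertical[OF assms(1,2), of x] by (auto intro!: integrable_continuous_interval)
next
  have "continuous_on (cbox a b \<times> cbox c d) (\<lambda>p. frechet_derivative f (at p) (1, 0))"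
    using assms(2) continuous_on_subset[OF smooth_on_continuous_on[OF smooth_on_frechet_derivative[OF assms(1)]]]
    by auto
  then show "continuous_on (cbox a b \<times> cbox c d)
      (\<lambda>(x, t). frechet_derivative f (at (x, t)) (1, 0))"
    by (simp add: split_beta)
qed (use assms(3) in auto)

text \<open>Both sides of \<open>f(x, y) = f(x, c) + \<integral>\<^sub>c\<^sup>y f\<^sub>v(x, t) dt\<close> are differentiated first in \<open>x\<close>, under the
  integral sign, and then in \<open>y\<close>.\<close>

lemma mixed_partials_commute:
  fixes f :: "real \<times> real \<Rightarrow> 'b::euclidean_space"
  assumes "open U" and smooth: "smooth_on f U" and "p \<in> U"
  shows "frechet_derivative (\<lambda>q. frechet_derivative f (at q) (0, 1)) (at p) (1, 0) =
    frechet_derivative (\<lambda>q. frechet_derivative f (at q) (1, 0)) (at p) (0, 1)"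
proof -
  obtain u v where p: "p = (u, v)" by (cases p)
  obtain a b c d where u: "a < u" "u < b" and v: "c < v" "v < d" and sub: "{a..b} \<times> {c..d} \<subseteq> U"
    using open_rectangle_in[of U u v] assms(1,3) p by blast
  define fu fv where "fu = (\<lambda>q. frechet_derivative f (at q) (1, 0))"
    and "fv = (\<lambda>q. frechet_derivative f (at q) (0, 1))"
  have fu: "smooth_on fu U" and fv: "smooth_on fv U"
    unfolding fu_def fv_def by (rule smooth_on_frechet_derivative[OF smooth])+
  define fvu where "fvu = (\<lambda>q. frechet_derivative fv (at q) (1, 0))"
  have fvu: "smooth_on fvu U"
    unfolding fvu_def by (rule smooth_on_frechet_derivative[OF fv])
  note df = smooth_on_has_derivative[OF smooth]
  have ftc: "integral {c..y} (\<lambda>t. fv (x, t)) = f (x, y) - f (x, c)"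
    if "x \<in> {a..b}" "y \<in> {c..d}" for x y
    unfolding fv_def
    by (intro integral_unique fundamental_theorem_of_calculus has_vector_derivative_snd df)
      (use that sub in auto)
  have fu_eq: "fu (u, y) = integral {c..y} (\<lambda>t. fvu (u, t)) + fu (u, c)" if y: "y \<in> {c..d}" for y
  proof -
    have *: "at u within {a..b} = at u" using u by (simp add: at_within_Icc_at)
    have "((\<lambda>x. integral {c..y} (\<lambda>t. fv (x, t))) has_vector_derivative
        integral {c..y} (\<lambda>t. fvu (u, t))) (at u within {a..b})"
      unfolding fvu_def
      by (rule has_vector_derivative_vertical_integral[OF fv]) (use y u sub in auto)
    then have "((\<lambda>x. f (x, y) - f (x, c)) has_vector_derivative
        integral {c..y} (\<lambda>t. fvu (u, t))) (at u within {a..b})"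
      by (rule has_vector_derivative_transform[rotated 2]) (use u y in \<open>auto simp: ftc\<close>)
    moreover have "((\<lambda>x. f (x, y) - f (x, c)) has_vector_derivative fu (u, y) - fu (u, c))
        (at u within {a..b})"
      unfolding fu_def
      by (intro has_vector_derivative_diff has_vector_derivative_fst df) (use y u v sub in auto)
    ultimately show ?thesis
      unfolding * by (metis vector_derivative_unique_at diff_add_cancel)
  qed
  have *: "at v within {c..d} = at v" using v by (simp add: at_within_Icc_at)
  have "((\<lambda>y. integral {c..y} (\<lambda>t. fvu (u, t)) + fu (u, c)) has_vector_derivative fvu (u, v) + 0)
      (at v within {c..d})"
    by (intro has_vector_derivative_add integral_has_vector_derivative has_vector_derivative_const
        continuous_on_vertical[OF fvu sub]) (use u v in auto)
  then have "((\<lambda>y. fu (u, y)) has_vector_derivative fvu (u, v) + 0) (at v within {c..d})"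
    by (rule has_vector_derivative_transform[rotated 2]) (use v in simp, rule fu_eq)
  moreover have "((\<lambda>y. fu (u, y)) has_vector_derivative frechet_derivative fu (at (u, v)) (0, 1))
      (at v within {c..d})"
    by (intro has_vector_derivative_snd smooth_on_has_derivative[OF fu]) (use assms p in simp)
  ultimately show ?thesis
    unfolding * p fvu_def fu_def fv_def add_0_right by (rule vector_derivative_unique_at)
qed

text \<open>The Poincare lemma on a rectangle. The potential integrates \<open>P du + Q dv\<close> from the corner
  \<open>(a, c)\<close> along the lower edge and then vertically.\<close>

lemma closed_form_has_potential:
  fixes P Q :: "real \<times> real \<Rightarrow> 'b::euclidean_space"
  assumes P: "smooth_on P U" and Q: "smooth_on Q U" and sub: "{a..b} \<times> {c..d} \<subseteq> U"
    and closed: "\<And>q. q \<in> U \<Longrightarrow> frechet_derivative Q (at q) (1, 0) = frechet_derivative P (at q) (0, 1)"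
  obtains F where "\<And>q. q \<in> {a<..<b} \<times> {c<..<d} \<Longrightarrow>
      (F has_derivative (\<lambda>(x, y). x *\<^sub>R P q + y *\<^sub>R Q q)) (at q)"
proof
  define F where "F = (\<lambda>u v. integral {a..u} (\<lambda>s. P (s, c)) + integral {c..v} (\<lambda>t. Q (u, t)))"
  fix q assume q: "q \<in> {a<..<b} \<times> {c<..<d}"
  obtain u v where uv: "q = (u, v)" by (cases q)
  have u: "u \<in> {a..b}" "a < u" "u < b" and v: "v \<in> {c..d}" "c < v" "v < d" using q uv by auto
  have Pv: "integral {c..v} (\<lambda>t. frechet_derivative Q (at (u, t)) (1, 0)) = P (u, v) - P (u, c)"
  proof -
    have "integral {c..v} (\<lambda>t. frechet_derivative Q (at (u, t)) (1, 0)) =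
        integral {c..v} (\<lambda>t. frechet_derivative P (at (u, t)) (0, 1))"
      by (rule integral_cong, rule closed) (use u v sub in auto)
    also have "\<dots> = P (u, v) - P (u, c)"
      by (intro integral_unique fundamental_theorem_of_calculus has_vector_derivative_snd
          smooth_on_has_derivative[OF P]) (use u v sub in auto)
    finally show ?thesis .
  qed
  have lower: "continuous_on {a..b} (\<lambda>s. P (s, c))"
    by (rule continuous_on_compose2[OF smooth_on_continuous_on[OF P]])
      (use sub v in \<open>auto intro!: continuous_intros\<close>)
  have "((\<lambda>x. F x v) has_vector_derivative
      P (u, c) + integral {c..v} (\<lambda>t. frechet_derivative Q (at (u, t)) (1, 0))) (at u within {a..b})"
    unfolding F_def
    by (intro has_vector_derivative_add integral_has_vector_derivative[OF lower u(1)]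
        has_vector_derivative_vertical_integral[OF Q _ u(1)]) (use v sub in auto)
  then have Fu: "((\<lambda>x. F x v) has_derivative (\<lambda>h. h *\<^sub>R P (u, v))) (at u within {a..b})"
    by (simp add: Pv has_vector_derivative_def)
  have Fv: "((\<lambda>y. F x y) has_derivative blinfun_apply (blinfun_scaleR_left (Q (x, y)))) (at y within {c..d})"
    if "x \<in> {a..b}" "y \<in> {c..d}" for x y
  proof -
    have "((\<lambda>y. F x y) has_vector_derivative 0 + Q (x, y)) (at y within {c..d})"
      unfolding F_def
      by (intro has_vector_derivative_add has_vector_derivative_const
          integral_has_vector_derivative[OF continuous_on_vertical[OF Q sub that(1)] that(2)])
    then show ?thesis by (simp add: has_vector_derivative_def)
  qed
  have "continuous_on ({a..b} \<times> {c..d}) (\<lambda>q. blinfun_scaleR_left (Q q))"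
    by (intro continuous_intros continuous_on_subset[OF smooth_on_continuous_on[OF Q] sub])
  then have "continuous (at (u, v) within {a..b} \<times> {c..d}) (\<lambda>(x, y). blinfun_scaleR_left (Q (x, y)))"
    unfolding split_def prod.collapse using u v by (simp add: continuous_on_eq_continuous_within)
  from has_derivative_partialsI[OF Fu Fv this v(1) convex_real_interval(5)]
  have "((\<lambda>(x, y). F x y) has_derivative (\<lambda>(x, y). x *\<^sub>R P (u, v) + y *\<^sub>R Q (u, v)))
      (at (u, v) within {a..b} \<times> {c..d})" by simp
  then have "((\<lambda>(x, y). F x y) has_derivative (\<lambda>(x, y). x *\<^sub>R P (u, v) + y *\<^sub>R Q (u, v)))
      (at (u, v) within {a<..<b} \<times> {c<..<d})"
    by (rule has_derivative_subset) auto
  moreover have "at (u, v) within {a<..<b} \<times> {c<..<d} = at (u, v)"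
    by (rule at_within_open) (use q uv in \<open>auto intro!: open_Times\<close>)
  ultimately show "((\<lambda>(x, y). F x y) has_derivative (\<lambda>(x, y). x *\<^sub>R P q + y *\<^sub>R Q q)) (at q)"
    using uv by simp
qed

text \<open>By Cramer's rule the derivative of the inverse is a rational expression in the first derivatives
  of \<open>\<xi>\<close> along the inverse. So an inverse of class \<open>C\<^sup>k\<close> has a derivative of class \<open>C\<^sup>k\<close>, that is, it
  is of class \<open>C\<^bsup>k+1\<^esup>\<close>.\<close>

lemma smooth_on_inverse_plane:
  fixes \<xi> g :: "real \<times> real \<Rightarrow> real \<times> real"
  assumes "open U" and "open V" and \<xi>: "smooth_on \<xi> U" and gV: "g ` V \<subseteq> U"
    and g: "\<And>y. y \<in> V \<Longrightarrow> (g has_derivative g' y) (at y)"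
    and inv: "\<And>y w. y \<in> V \<Longrightarrow> frechet_derivative \<xi> (at (g y)) (g' y w) = w"
  shows "smooth_on g V"
proof (rule smooth_onI)
  define xu xv yu yv where "xu = (\<lambda>q. fst (frechet_derivative \<xi> (at q) (1, 0)))"
    and "xv = (\<lambda>q. fst (frechet_derivative \<xi> (at q) (0, 1)))"
    and "yu = (\<lambda>q. snd (frechet_derivative \<xi> (at q) (1, 0)))"
    and "yv = (\<lambda>q. snd (frechet_derivative \<xi> (at q) (0, 1)))"
  define J where "J = (\<lambda>q. xu q * yv q - xv q * yu q)"
  have d\<xi>: "frechet_derivative \<xi> (at q) (s, t) = (s * xu q + t * xv q, s * yu q + t * yv q)"
    if "q \<in> U" for q s t
    using linear_plane[OF has_derivative_linear[OF smooth_on_has_derivative[OF \<xi> that]], of s t]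
    by (simp add: xu_def xv_def yu_def yv_def prod_eq_iff)
  have smooth: "smooth_on xu U" "smooth_on xv U" "smooth_on yu U" "smooth_on yv U" "smooth_on J U"
    unfolding J_def xu_def xv_def yu_def yv_def
    by (intro smooth_on_diff smooth_on_mult \<open>open U\<close> smooth_on_frechet_derivative[OF \<xi>]
        smooth_on_bounded_linear[OF bounded_linear_fst] smooth_on_bounded_linear[OF bounded_linear_snd])+
  have J: "J (g y) \<noteq> 0" and g'_eq: "g' y (s, t) = ((yv (g y) * s - xv (g y) * t) / J (g y),
      (xu (g y) * t - yu (g y) * s) / J (g y))" if "y \<in> V" for y s t
  proof -
    have U: "g y \<in> U" using gV that by auto
    have sol: "fst (g' y w) * xu (g y) + snd (g' y w) * xv (g y) = fst w"
      "fst (g' y w) * yu (g y) + snd (g' y w) * yv (g y) = snd w" for w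
      using inv[OF that, of w] d\<xi>[OF U, of "fst (g' y w)" "snd (g' y w)"] by (auto simp: prod_eq_iff)
    have cramer: "fst (g' y w) * J (g y) = yv (g y) * fst w - xv (g y) * snd w"
      "snd (g' y w) * J (g y) = xu (g y) * snd w - yu (g y) * fst w" for w
      unfolding J_def sol(1)[of w, symmetric] sol(2)[of w, symmetric] by algebra+
    show J: "J (g y) \<noteq> 0"
    proof
      assume "J (g y) = 0"
      then have "xu (g y) = 0" "xv (g y) = 0"
        using cramer[of "(0, 1)"] by simp_all
      then show False using sol(1)[of "(1, 0)"] by simp
    qed
    show "g' y (s, t) = ((yv (g y) * s - xv (g y) * t) / J (g y),
      (xu (g y) * t - yu (g y) * s) / J (g y))"
      using cramer[of "(s, t)"] J by (simp add: prod_eq_iff field_simps)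
  qed
  define \<tau> where "\<tau> = (\<lambda>w q. ((yv q * fst w - xv q * snd w) / J q, (xu q * snd w - yu q * fst w) / J q))"
  have \<tau>: "smooth_on (\<tau> w) {q \<in> U. J q \<noteq> 0}" for w
  proof -
    have "open {q \<in> U. J q \<noteq> 0}"
      using continuous_open_preimage[OF smooth_on_continuous_on[OF smooth(5)] \<open>open U\<close>, of "- {0}"]
      by (simp add: vimage_def Int_def open_Compl)
    then show ?thesis
      unfolding \<tau>_def
      by (intro smooth_on_Pair smooth_on_divide smooth_on_diff smooth_on_mult smooth_on_const
          smooth[THEN smooth_on_subset]) auto
  qed
  fix k
  show "Ck_on k g V"
  proof (induction k)
    case 0
    show ?case
      using g by (auto intro!: continuous_at_imp_continuous_on has_derivative_continuous)
  next
    case (Suc k)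
    show ?case
    proof (rule Ck_on_SucI[OF \<open>open V\<close>, where f' = "\<lambda>y w. \<tau> w (g y)"])
      fix y assume "y \<in> V"
      then show "(g has_derivative (\<lambda>w. \<tau> w (g y))) (at y)"
        using g[of y] g'_eq[of y] by (intro has_derivative_eq_rhs[OF g]) (auto simp: \<tau>_def fun_eq_iff)
    next
      fix w
      have "g ` V \<subseteq> {q \<in> U. J q \<noteq> 0}" using gV J by auto
      then show "Ck_on k (\<lambda>y. \<tau> w (g y)) V"
        by (rule Ck_on_compose[OF \<open>open V\<close> smooth_onD[OF \<tau>] Suc])
    qed
  qed
qed

lemma smooth_inverse_function_plane:
  fixes \<xi> :: "real \<times> real \<Rightarrow> real \<times> real"
  assumes "open U" and \<xi>: "smooth_on \<xi> U" and "p \<in> U"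
    and inj: "inj (frechet_derivative \<xi> (at p))"
  obtains U' V g where "open U'" "U' \<subseteq> U" "p \<in> U'" "open V" "homeomorphism U' V \<xi> g"
    "smooth_on g V" "\<And>y. y \<in> V \<Longrightarrow> surj (frechet_derivative \<xi> (at (g y)))"
proof -
  define d\<xi> where "d\<xi> = (\<lambda>q. Blinfun (frechet_derivative \<xi> (at q)))"
  have d\<xi>: "blinfun_apply (d\<xi> q) = frechet_derivative \<xi> (at q)" if "q \<in> U" for q
    unfolding d\<xi>_def
    by (intro bounded_linear_Blinfun_apply has_derivative_bounded_linear[OF smooth_on_has_derivative[OF \<xi> that]])
  have der: "(\<xi> has_derivative blinfun_apply (d\<xi> q)) (at q)" if "q \<in> U" for q
    unfolding d\<xi>[OF that] by (rule smooth_on_has_derivative[OF \<xi> that])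
  have cont: "continuous_on U d\<xi>"
  proof (rule continuous_on_blinfun_componentwise)
    fix w :: "real \<times> real"
    show "continuous_on U (\<lambda>q. d\<xi> q w)"
      by (rule continuous_on_eq[OF smooth_on_continuous_on[OF smooth_on_frechet_derivative[OF \<xi>, of w]]])
        (simp add: d\<xi>)
  qed
  have lin: "linear (frechet_derivative \<xi> (at p))"
    by (rule has_derivative_linear[OF smooth_on_has_derivative[OF \<xi> \<open>p \<in> U\<close>]])
  obtain L where L: "linear L" "L \<circ> frechet_derivative \<xi> (at p) = id"
    using linear_injective_left_inverse[OF lin inj] by blast
  have "blinfun_apply (Blinfun L) = L"
    using L(1) by (intro bounded_linear_Blinfun_apply) (simp add: linear_conv_bounded_linear)
  with L(2) have "Blinfun L o\<^sub>L d\<xi> p = id_blinfun"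
    by (intro blinfun_eqI) (metis blinfun_apply_blinfun_compose blinfun_apply_id_blinfun comp_apply d\<xi>[OF \<open>p \<in> U\<close>] id_apply)
  from inverse_function_theorem[OF \<open>open U\<close> der cont \<open>p \<in> U\<close> this]
  obtain U' V g g' where *: "open U'" "U' \<subseteq> U" "p \<in> U'" "open V" "homeomorphism U' V \<xi> g"
    and g: "\<And>y. y \<in> V \<Longrightarrow> (g has_derivative g' y) (at y)"
    and g': "\<And>y. y \<in> V \<Longrightarrow> g' y = inv (blinfun_apply (d\<xi> (g y)))"
    and bij: "\<And>y. y \<in> V \<Longrightarrow> bij (blinfun_apply (d\<xi> (g y)))"
    by metis
  have gV: "g ` V \<subseteq> U" using *(2,5) by (auto simp: homeomorphism_def)
  have surj: "surj (frechet_derivative \<xi> (at (g y)))" if "y \<in> V" for y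
    using bij[OF that] d\<xi>[of "g y"] gV that by (auto simp: bij_def)
  have "smooth_on g V"
  proof (rule smooth_on_inverse_plane[OF \<open>open U\<close> \<open>open V\<close> \<xi> gV g])
    fix y w assume "y \<in> V"
    then show "frechet_derivative \<xi> (at (g y)) (g' y w) = w"
      using surj[of y] g'[of y] d\<xi>[of "g y"] gV by (auto simp: surj_f_inv_f)
  qed
  with * surj that show thesis by blast
qed


section \<open>The neutral scalar product\<close>

lemma bounded_bilinear_inner22: "bounded_bilinear inner22"
  by (simp add: bilinear_conv_bounded_bilinear[symmetric] bilinear_def linear_iff inner22_def algebra_simps)

lemma inner22_commute: "inner22 X Y = inner22 Y X"
  by (simp add: inner22_def algebra_simps)

lemmas inner22_linear =
  bounded_bilinear.add_left[OF bounded_bilinear_inner22] bounded_bilinear.add_right[OF bounded_bilinear_inner22]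
  bounded_bilinear.diff_left[OF bounded_bilinear_inner22] bounded_bilinear.diff_right[OF bounded_bilinear_inner22]
  bounded_bilinear.scaleR_left[OF bounded_bilinear_inner22] bounded_bilinear.scaleR_right[OF bounded_bilinear_inner22]

lemmas frechet_derivative_rules =
  frechet_derivative_bounded_bilinear[OF bounded_bilinear_inner22]
  frechet_derivative_bounded_bilinear[OF bounded_bilinear_scaleR]
  frechet_derivative_bounded_bilinear[OF bounded_bilinear_mult]
  frechet_derivative_minus_smooth


section \<open>The conjugate form of a minimal surface\<close>

text \<open>In terms of a pseudo-orthonormal basis of the plane, minus the Gram determinant of \<open>X\<close> and \<open>Y\<close> is the
  square of their coordinate determinant.\<close>

lemma lorentzian_gram_negative:
  fixes L :: "real \<times> real \<Rightarrow> real^4"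
  assumes lin: "linear L" and inj: "inj L" and sig: "signature_1_1 (range L)"
  defines "X \<equiv> L (1, 0)" and "Y \<equiv> L (0, 1)"
  shows "0 < (inner22 X Y)\<^sup>2 - inner22 X X * inner22 Y Y"
proof -
  obtain M N where T: "range L = span {M, N}" and MN: "inner22 M M = 1" "inner22 N N = -1" "inner22 M N = 0"
    using sig by (auto simp: signature_1_1_def)
  have NM: "inner22 N M = 0" using MN(3) by (simp add: inner22_commute)
  have mem: "\<exists>a b. V = a *\<^sub>R M + b *\<^sub>R N" if "V \<in> range L" for V
    using that unfolding T by (auto simp: span_insert span_singleton algebra_simps)
  obtain a b where X: "X = a *\<^sub>R M + b *\<^sub>R N" using mem unfolding X_def by blast
  obtain c d where Y: "Y = c *\<^sub>R M + d *\<^sub>R N" using mem unfolding Y_def by blast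
  have gram: "(inner22 X Y)\<^sup>2 - inner22 X X * inner22 Y Y = (a * d - b * c)\<^sup>2"
    unfolding X Y by (simp add: inner22_linear MN NM power2_eq_square algebra_simps)
  have L: "L (x, y) = (x * a + y * c) *\<^sub>R M + (x * b + y * d) *\<^sub>R N" for x y
    unfolding linear_plane[OF lin, of x y] X_def[symmetric] Y_def[symmetric] X Y
    by (simp add: algebra_simps)
  have zero: "z = 0" if "L z = 0" for z
    using that inj linear_0[OF lin] by (metis injD)
  \<comment> \<open>If the determinant vanished, then \<open>(d, - b)\<close> and \<open>(c, - a)\<close> would lie in the kernel of \<open>L\<close>.\<close>
  have "a * d - b * c \<noteq> 0"
  proof
    assume det: "a * d - b * c = 0"
    then have "L (d, - b) = 0" "L (c, - a) = 0" by (simp_all add: L algebra_simps)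
    then have "(d, - b) = 0" "(c, - a) = 0" using zero by blast+
    then have "a = 0" "b = 0" "c = 0" "d = 0" by (simp_all add: zero_prod_def)
    then have "L (1, 0) = 0" by (simp add: L)
    then have "(1, 0) = (0 :: real \<times> real)" using zero by blast
    then show False by (simp add: zero_prod_def)
  qed
  then show ?thesis by (simp add: gram)
qed

definition area_density :: "(real \<times> real \<Rightarrow> real^4) \<Rightarrow> real \<times> real \<Rightarrow> real" where
  "area_density \<Psi> p = sqrt ((coeff_F \<Psi> p)\<^sup>2 - coeff_E \<Psi> p * coeff_G \<Psi> p)"

text \<open>\<open>conjugate_u\<close> and \<open>conjugate_v\<close> are the values of \<open>* d\<Psi>\<close> on the two coordinate directions, where
  \<open>*\<close> is the Hodge star of the induced Lorentzian metric for one of the two orientations.\<close>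

definition conjugate_u :: "(real \<times> real \<Rightarrow> real^4) \<Rightarrow> real \<times> real \<Rightarrow> real^4" where
  "conjugate_u \<Psi> p =
    (coeff_F \<Psi> p / area_density \<Psi> p) *\<^sub>R frechet_derivative \<Psi> (at p) (1, 0)
    - (coeff_E \<Psi> p / area_density \<Psi> p) *\<^sub>R frechet_derivative \<Psi> (at p) (0, 1)"

definition conjugate_v :: "(real \<times> real \<Rightarrow> real^4) \<Rightarrow> real \<times> real \<Rightarrow> real^4" where
  "conjugate_v \<Psi> p =
    (coeff_G \<Psi> p / area_density \<Psi> p) *\<^sub>R frechet_derivative \<Psi> (at p) (1, 0)
    - (coeff_F \<Psi> p / area_density \<Psi> p) *\<^sub>R frechet_derivative \<Psi> (at p) (0, 1)"

lemma lorentzian_surfaceD: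
  assumes "lorentzian_surface \<Psi> U"
  shows "open U" and "smooth_on \<Psi> U"
    and "p \<in> U \<Longrightarrow> inj (frechet_derivative \<Psi> (at p))"
    and "p \<in> U \<Longrightarrow> signature_1_1 (tangent_space \<Psi> p)"
    and "p \<in> U \<Longrightarrow> linear (frechet_derivative \<Psi> (at p))"
  using assms has_derivative_linear[OF smooth_on_has_derivative[of \<Psi> U p]]
  by (auto simp: lorentzian_surface_def)

lemma area_density_pos:
  assumes "lorentzian_surface \<Psi> U" and "p \<in> U"
  shows "0 < (coeff_F \<Psi> p)\<^sup>2 - coeff_E \<Psi> p * coeff_G \<Psi> p" and "0 < area_density \<Psi> p"
    and "(area_density \<Psi> p)\<^sup>2 = (coeff_F \<Psi> p)\<^sup>2 - coeff_E \<Psi> p * coeff_G \<Psi> p"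
proof -
  note D = lorentzian_surfaceD[OF assms(1)]
  show "0 < (coeff_F \<Psi> p)\<^sup>2 - coeff_E \<Psi> p * coeff_G \<Psi> p"
    using lorentzian_gram_negative[OF D(5,3) D(4)[unfolded tangent_space_def]] assms(2)
    by (simp add: coeff_E_def coeff_F_def coeff_G_def)
  then show "0 < area_density \<Psi> p"
    and "(area_density \<Psi> p)\<^sup>2 = (coeff_F \<Psi> p)\<^sup>2 - coeff_E \<Psi> p * coeff_G \<Psi> p"
    by (simp_all add: area_density_def)
qed

text \<open>As an operator on the tangent plane the star is skew-adjoint with square \<open>1\<close>, hence reverses the sign
  of the induced metric.\<close>

lemma conjugate_products:
  assumes "lorentzian_surface \<Psi> U" and "p \<in> U"
  defines "X \<equiv> frechet_derivative \<Psi> (at p) (1, 0)" and "Y \<equiv> frechet_derivative \<Psi> (at p) (0, 1)"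
    and "P \<equiv> conjugate_u \<Psi> p" and "Q \<equiv> conjugate_v \<Psi> p"
  shows "inner22 P X = 0" and "inner22 P Y = area_density \<Psi> p"
    and "inner22 Q X = - area_density \<Psi> p" and "inner22 Q Y = 0"
    and "inner22 P P = - inner22 X X" and "inner22 P Q = - inner22 X Y" and "inner22 Q Q = - inner22 Y Y"
proof -
  define E F G W where EFG: "E = coeff_E \<Psi> p" "F = coeff_F \<Psi> p" "G = coeff_G \<Psi> p"
    and W: "W = area_density \<Psi> p"
  have XY: "inner22 X X = E" "inner22 X Y = F" "inner22 Y X = F" "inner22 Y Y = G"
    by (simp_all add: EFG X_def Y_def coeff_E_def coeff_F_def coeff_G_def inner22_commute)
  have PQ: "P = (F / W) *\<^sub>R X - (E / W) *\<^sub>R Y" "Q = (G / W) *\<^sub>R X - (F / W) *\<^sub>R Y"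
    by (simp_all add: P_def Q_def conjugate_u_def conjugate_v_def EFG W X_def Y_def)
  have W0: "W \<noteq> 0" and W2: "W * W = F * F - E * G"
    using area_density_pos[OF assms(1,2)] by (auto simp: W EFG power2_eq_square)
  have "inner22 P X = (F * E - E * F) / W" "inner22 P Y = (F * F - E * G) / W"
    "inner22 Q X = - ((F * F - E * G) / W)" "inner22 Q Y = (G * F - F * G) / W"
    by (simp_all add: PQ XY inner22_linear diff_divide_distrib)
  moreover have "inner22 P P = - E * ((F * F - E * G) / (W * W))"
    "inner22 P Q = - F * ((F * F - E * G) / (W * W))" "inner22 Q Q = - G * ((F * F - E * G) / (W * W))"
    by (simp_all add: PQ XY inner22_linear W0 field_simps)
  ultimately show "inner22 P X = 0" "inner22 P Y = area_density \<Psi> p"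
    "inner22 Q X = - area_density \<Psi> p" "inner22 Q Y = 0"
    "inner22 P P = - inner22 X X" "inner22 P Q = - inner22 X Y" "inner22 Q Q = - inner22 Y Y"
    unfolding W2[symmetric] XY W[symmetric] using W0 by simp_all
qed

lemma smooth_on_first_fundamental_form:
  assumes "lorentzian_surface \<Psi> U"
  shows "smooth_on (coeff_E \<Psi>) U" and "smooth_on (coeff_F \<Psi>) U" and "smooth_on (coeff_G \<Psi>) U"
    and "smooth_on (area_density \<Psi>) U"
proof -
  note D = lorentzian_surfaceD[OF assms]
  show *: "smooth_on (coeff_E \<Psi>) U" "smooth_on (coeff_F \<Psi>) U" "smooth_on (coeff_G \<Psi>) U"
    unfolding coeff_E_def[abs_def] coeff_F_def[abs_def] coeff_G_def[abs_def]
    by (intro smooth_on_bounded_bilinear[OF bounded_bilinear_inner22] smooth_on_frechet_derivative D)+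
  show "smooth_on (area_density \<Psi>) U"
    unfolding area_density_def[abs_def] power2_eq_square
    by (intro smooth_on_sqrt smooth_on_diff smooth_on_mult * D)
      (use area_density_pos(1)[OF assms] in \<open>simp add: power2_eq_square\<close>)
qed

lemma smooth_on_conjugate:
  assumes "lorentzian_surface \<Psi> U"
  shows "smooth_on (conjugate_u \<Psi>) U" and "smooth_on (conjugate_v \<Psi>) U"
  unfolding conjugate_u_def[abs_def] conjugate_v_def[abs_def]
  using area_density_pos(2)[OF assms]
  by (intro smooth_on_diff smooth_on_scaleR smooth_on_divide smooth_on_frechet_derivative
      smooth_on_first_fundamental_form[OF assms] lorentzian_surfaceD[OF assms]; force)+

text \<open>A vanishing mean curvature vector says that the normal components of the second derivatives have zero
  trace, and every vector differs from its normal component by a tangent vector.\<close>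

lemma minimal_imp_tangential_trace:
  assumes "minimal_lorentzian_surface \<Psi> U" and "p \<in> U"
  defines "\<Psi>u \<equiv> \<lambda>q. frechet_derivative \<Psi> (at q) (1, 0)"
    and "\<Psi>v \<equiv> \<lambda>q. frechet_derivative \<Psi> (at q) (0, 1)"
  shows "coeff_G \<Psi> p *\<^sub>R frechet_derivative \<Psi>u (at p) (1, 0)
    - (2 * coeff_F \<Psi> p) *\<^sub>R frechet_derivative \<Psi>v (at p) (1, 0)
    + coeff_E \<Psi> p *\<^sub>R frechet_derivative \<Psi>v (at p) (0, 1) \<in> tangent_space \<Psi> p"
proof -
  have lor: "lorentzian_surface \<Psi> U" and H: "mean_curvature_vector \<Psi> p = 0"
    using assms(1,2) by (auto simp: minimal_lorentzian_surface_def)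
  note D = lorentzian_surfaceD[OF lor]
  have T: "subspace (tangent_space \<Psi> p)"
    unfolding tangent_space_def by (intro linear_subspace_image D(5) subspace_UNIV assms(2))
  define II where "II = second_fundamental_form \<Psi> p"
  have tan: "frechet_derivative (\<lambda>q. frechet_derivative \<Psi> (at q) b) (at p) a - II a b
      \<in> tangent_space \<Psi> p" for a b
    unfolding II_def second_fundamental_form_def normal_component_def
    using theI'[OF normal_component_ex1[OF D(4)[OF assms(2)]]] by blast
  have "coeff_G \<Psi> p *\<^sub>R II (1, 0) (1, 0) - (2 * coeff_F \<Psi> p) *\<^sub>R II (1, 0) (0, 1)
      + coeff_E \<Psi> p *\<^sub>R II (0, 1) (0, 1) = 0"
    using H area_density_pos(1)[OF lor assms(2)] by (simp add: mean_curvature_vector_def II_def)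
  then have "coeff_G \<Psi> p *\<^sub>R frechet_derivative \<Psi>u (at p) (1, 0)
    - (2 * coeff_F \<Psi> p) *\<^sub>R frechet_derivative \<Psi>v (at p) (1, 0)
    + coeff_E \<Psi> p *\<^sub>R frechet_derivative \<Psi>v (at p) (0, 1) =
    coeff_G \<Psi> p *\<^sub>R (frechet_derivative \<Psi>u (at p) (1, 0) - II (1, 0) (1, 0))
    - (2 * coeff_F \<Psi> p) *\<^sub>R (frechet_derivative \<Psi>v (at p) (1, 0) - II (1, 0) (0, 1))
    + coeff_E \<Psi> p *\<^sub>R (frechet_derivative \<Psi>v (at p) (0, 1) - II (0, 1) (0, 1))"
    by (simp add: algebra_simps)
  moreover have "coeff_G \<Psi> p *\<^sub>R (frechet_derivative \<Psi>u (at p) (1, 0) - II (1, 0) (1, 0))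
    - (2 * coeff_F \<Psi> p) *\<^sub>R (frechet_derivative \<Psi>v (at p) (1, 0) - II (1, 0) (0, 1))
    + coeff_E \<Psi> p *\<^sub>R (frechet_derivative \<Psi>v (at p) (0, 1) - II (0, 1) (0, 1)) \<in> tangent_space \<Psi> p"
    unfolding \<Psi>u_def \<Psi>v_def by (intro subspace_add subspace_diff subspace_scale T tan)
  ultimately show ?thesis by simp
qed

text \<open>Put \<open>D = Q\<^sub>u - P\<^sub>v\<close> for the components \<open>P\<close>, \<open>Q\<close> of the conjugate form. Up to tangential terms \<open>D\<close> is
  the trace of the second derivative of \<open>\<Psi>\<close>, whose normal part is a multiple of the mean curvature
  vector. The tangential part of \<open>D\<close> vanishes on every surface: differentiating the products of \<open>P\<close> and
  \<open>Q\<close> with \<open>\<Psi>\<^sub>u\<close> and \<open>\<Psi>\<^sub>v\<close> expresses it through second derivatives of \<open>\<Psi>\<close>, and all terms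
  cancel. So minimality makes \<open>D\<close> a tangent vector orthogonal to the non-degenerate tangent plane.\<close>

lemma minimal_imp_conjugate_closed:
  assumes "minimal_lorentzian_surface \<Psi> U" and p: "p \<in> U"
  shows "frechet_derivative (conjugate_v \<Psi>) (at p) (1, 0) = frechet_derivative (conjugate_u \<Psi>) (at p) (0, 1)"
proof -
  have lor: "lorentzian_surface \<Psi> U" using assms by (simp add: minimal_lorentzian_surface_def)
  note surf = lorentzian_surfaceD[OF lor]
  define \<Psi>u \<Psi>v where "\<Psi>u = (\<lambda>q. frechet_derivative \<Psi> (at q) (1, 0))"
    and "\<Psi>v = (\<lambda>q. frechet_derivative \<Psi> (at q) (0, 1))"
  define E F G W P Q where EFG: "E = coeff_E \<Psi>" "F = coeff_F \<Psi>" "G = coeff_G \<Psi>"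
    and "W = area_density \<Psi>" and PQ: "P = conjugate_u \<Psi>" "Q = conjugate_v \<Psi>"
  have smooth: "smooth_on \<Psi>u U" "smooth_on \<Psi>v U" "smooth_on E U" "smooth_on F U" "smooth_on G U"
    "smooth_on W U" "smooth_on P U" "smooth_on Q U"
    unfolding \<Psi>u_def \<Psi>v_def EFG W_def PQ
    by (intro smooth_on_frechet_derivative smooth_on_first_fundamental_form[OF lor]
        smooth_on_conjugate[OF lor] surf)+
  have W0: "W q \<noteq> 0" and W2: "W q * W q = F q * F q - E q * G q" if "q \<in> U" for q
    using area_density_pos[OF lor that] by (auto simp: W_def EFG power2_eq_square)
  have quot: "smooth_on (\<lambda>q. E q / W q) U" "smooth_on (\<lambda>q. F q / W q) U" "smooth_on (\<lambda>q. G q / W q) U"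
    by (intro smooth_on_divide smooth surf(1) W0; assumption)+
  define uu uv vv where "uu = frechet_derivative \<Psi>u (at p) (1, 0)"
    and "uv = frechet_derivative \<Psi>v (at p) (1, 0)" and "vv = frechet_derivative \<Psi>v (at p) (0, 1)"
  have vu: "frechet_derivative \<Psi>u (at p) (0, 1) = uv"
    unfolding uv_def \<Psi>u_def \<Psi>v_def by (rule mixed_partials_commute[OF surf(1,2) p, symmetric])
  note second = uu_def[symmetric] uv_def[symmetric] vv_def[symmetric] vu
  define D where "D = frechet_derivative Q (at p) (1, 0) - frechet_derivative P (at p) (0, 1)"

  have PQ_eq: "P = (\<lambda>q. (F q / W q) *\<^sub>R \<Psi>u q - (E q / W q) *\<^sub>R \<Psi>v q)"
    "Q = (\<lambda>q. (G q / W q) *\<^sub>R \<Psi>u q - (F q / W q) *\<^sub>R \<Psi>v q)"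
    by (simp_all add: PQ conjugate_u_def conjugate_v_def EFG W_def \<Psi>u_def \<Psi>v_def fun_eq_iff)
  have tangent: "\<exists>x y. D = x *\<^sub>R \<Psi>u p + y *\<^sub>R \<Psi>v p"
  proof -
    define k l where "k = frechet_derivative (\<lambda>q. G q / W q) (at p) (1, 0) - frechet_derivative (\<lambda>q. F q / W q) (at p) (0, 1)"
      and "l = frechet_derivative (\<lambda>q. E q / W q) (at p) (0, 1) - frechet_derivative (\<lambda>q. F q / W q) (at p) (1, 0)"
    have "D = (1 / W p) *\<^sub>R (G p *\<^sub>R uu - (2 * F p) *\<^sub>R uv + E p *\<^sub>R vv) + k *\<^sub>R \<Psi>u p + l *\<^sub>R \<Psi>v p"
      unfolding D_def PQ_eq k_def l_def
      by (simp add: frechet_derivative_rules[OF _ _ p] smooth_on_scaleR smooth quot surf(1) second algebra_simps)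
        (simp add: vec_eq_iff)
    moreover obtain z where "G p *\<^sub>R uu - (2 * F p) *\<^sub>R uv + E p *\<^sub>R vv = frechet_derivative \<Psi> (at p) z"
      using minimal_imp_tangential_trace[OF assms(1) p]
      unfolding EFG uu_def uv_def vv_def \<Psi>u_def \<Psi>v_def tangent_space_def by blast
    moreover have "frechet_derivative \<Psi> (at p) z = fst z *\<^sub>R \<Psi>u p + snd z *\<^sub>R \<Psi>v p"
      using linear_plane[OF surf(5)[OF p], of "fst z" "snd z"] by (simp add: \<Psi>u_def \<Psi>v_def)
    ultimately have "D = (1 / W p) *\<^sub>R (fst z *\<^sub>R \<Psi>u p + snd z *\<^sub>R \<Psi>v p) + k *\<^sub>R \<Psi>u p + l *\<^sub>R \<Psi>v p"
      by (simp only:)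
    also have "\<dots> = (fst z / W p + k) *\<^sub>R \<Psi>u p + (snd z / W p + l) *\<^sub>R \<Psi>v p"
      by (simp add: algebra_simps)
    finally show ?thesis by blast
  qed

  have EFG_eq: "E = (\<lambda>q. inner22 (\<Psi>u q) (\<Psi>u q))" "F = (\<lambda>q. inner22 (\<Psi>u q) (\<Psi>v q))"
    "G = (\<lambda>q. inner22 (\<Psi>v q) (\<Psi>v q))"
    by (simp_all add: EFG coeff_E_def coeff_F_def coeff_G_def \<Psi>u_def \<Psi>v_def fun_eq_iff)
  note rules = frechet_derivative_rules[OF _ _ p]
  have dE: "frechet_derivative E (at p) (1, 0) = 2 * inner22 uu (\<Psi>u p)"
      "frechet_derivative E (at p) (0, 1) = 2 * inner22 uv (\<Psi>u p)"
    and dF: "frechet_derivative F (at p) (1, 0) = inner22 uu (\<Psi>v p) + inner22 uv (\<Psi>u p)"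
      "frechet_derivative F (at p) (0, 1) = inner22 uv (\<Psi>v p) + inner22 vv (\<Psi>u p)"
    and dG: "frechet_derivative G (at p) (1, 0) = 2 * inner22 uv (\<Psi>v p)"
      "frechet_derivative G (at p) (0, 1) = 2 * inner22 vv (\<Psi>v p)"
    unfolding EFG_eq by (simp_all add: rules smooth second inner22_commute)
  have dW: "2 * W p * frechet_derivative W (at p) a = 2 * F p * frechet_derivative F (at p) a
      - frechet_derivative E (at p) a * G p - E p * frechet_derivative G (at p) a" for a
  proof -
    have "frechet_derivative (\<lambda>q. W q * W q) (at p) a = frechet_derivative (\<lambda>q. F q * F q - E q * G q) (at p) a"
      by (rule fun_cong[OF frechet_derivative_cong_open[OF surf(1) _ p W2]])
        (intro smooth_on_mult surf(1) smooth)
    then show ?thesis by (simp add: rules smooth_on_mult surf(1) smooth algebra_simps)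
  qed
  have prods: "inner22 (P q) (\<Psi>u q) = 0" "inner22 (P q) (\<Psi>v q) = W q"
    "inner22 (Q q) (\<Psi>u q) = - W q" "inner22 (Q q) (\<Psi>v q) = 0" if "q \<in> U" for q
    unfolding PQ \<Psi>u_def \<Psi>v_def W_def by (rule conjugate_products[OF lor that])+
  have prod_rule: "inner22 (frechet_derivative Z (at p) a) (\<Psi>i p) =
      frechet_derivative h (at p) a - inner22 (Z p) (frechet_derivative \<Psi>i (at p) a)"
    if "smooth_on Z U" "smooth_on \<Psi>i U" "\<And>q. q \<in> U \<Longrightarrow> inner22 (Z q) (\<Psi>i q) = h q" for Z \<Psi>i h a
  proof -
    have "frechet_derivative (\<lambda>q. inner22 (Z q) (\<Psi>i q)) (at p) a = frechet_derivative h (at p) a"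
      by (rule fun_cong[OF frechet_derivative_cong_open[OF surf(1) _ p that(3)]])
        (intro smooth_on_bounded_bilinear[OF bounded_bilinear_inner22] surf(1) that)
    then show ?thesis by (simp add: rules that)
  qed
  have dminusW: "frechet_derivative (\<lambda>q. - W q) (at p) a = - frechet_derivative W (at p) a" for a
    using frechet_derivative_minus_smooth[OF smooth_on_const smooth(6) p, of 0] by simp
  have D_inner: "inner22 D (\<Psi>u p) = - frechet_derivative W (at p) (1, 0) - inner22 (Q p) uu + inner22 (P p) uv"
    "inner22 D (\<Psi>v p) = - frechet_derivative W (at p) (0, 1) - inner22 (Q p) uv + inner22 (P p) vv"
    unfolding D_def inner22_linear
    using prod_rule[OF smooth(8,1) prods(3), of "(1, 0)"] prod_rule[OF smooth(7,1) prods(1), of "(0, 1)"]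
      prod_rule[OF smooth(8,2) prods(4), of "(1, 0)"] prod_rule[OF smooth(7,2) prods(2), of "(0, 1)"]
    by (simp_all add: dminusW second)
  have WP: "W p * inner22 (P p) Z = F p * inner22 (\<Psi>u p) Z - E p * inner22 (\<Psi>v p) Z"
    and WQ: "W p * inner22 (Q p) Z = G p * inner22 (\<Psi>u p) Z - F p * inner22 (\<Psi>v p) Z" for Z
    unfolding PQ_eq using W0[OF p] by (simp_all add: inner22_linear right_diff_distrib)
  have "2 * (W p * inner22 D (\<Psi>u p)) = 0"
    using dW[of "(1, 0)"] WP[of uv] WQ[of uu] unfolding D_inner dE dF dG
    by (simp add: inner22_commute algebra_simps)
  moreover have "2 * (W p * inner22 D (\<Psi>v p)) = 0"
    using dW[of "(0, 1)"] WP[of vv] WQ[of uv] unfolding D_inner dE dF dG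
    by (simp add: inner22_commute algebra_simps)
  ultimately have orth: "inner22 D (\<Psi>u p) = 0" "inner22 D (\<Psi>v p) = 0"
    using W0[OF p] by simp_all

  obtain x y where D: "D = x *\<^sub>R \<Psi>u p + y *\<^sub>R \<Psi>v p" using tangent by blast
  have xy: "x * E p + y * F p = 0" "x * F p + y * G p = 0"
    using orth unfolding D by (simp_all add: EFG_eq inner22_linear inner22_commute)
  have "x * (W p * W p) = F p * (x * F p + y * G p) - G p * (x * E p + y * F p)"
    "y * (W p * W p) = F p * (x * E p + y * F p) - E p * (x * F p + y * G p)"
    unfolding W2[OF p] by algebra+
  then have "x = 0" "y = 0" using W0[OF p] unfolding xy by simp_all
  then show ?thesis using D by (simp add: D_def PQ)
qed


section \<open>Splitting a minimal surface into null curves\<close>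

lemma lorentzian_plane_null_basis:
  assumes "signature_1_1 T"
  obtains X Y where "X \<in> T" "Y \<in> T" "inner22 X X = 0" "inner22 Y Y = 0" "inner22 X Y = 2"
    "\<And>V. V \<in> T \<Longrightarrow> \<exists>x y. V = x *\<^sub>R X + y *\<^sub>R Y"
proof -
  obtain M N where T_eq: "T = span {M, N}" and MN: "inner22 M M = 1" "inner22 N N = -1" "inner22 M N = 0"
    using assms by (auto simp: signature_1_1_def)
  have NM: "inner22 N M = 0" using MN(3) by (simp add: inner22_commute)
  show thesis
  proof (rule that[of "M + N" "M - N"])
    show "M + N \<in> T" "M - N \<in> T" by (simp_all add: T_eq span_add span_diff span_base)
    show "inner22 (M + N) (M + N) = 0" "inner22 (M - N) (M - N) = 0" "inner22 (M + N) (M - N) = 2"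
      by (simp_all add: inner22_linear MN NM)
    fix V assume "V \<in> T"
    then obtain a b where "V = a *\<^sub>R M + b *\<^sub>R N"
      unfolding T_eq by (auto simp: span_insert span_singleton algebra_simps)
    then have "V = ((a + b) / 2) *\<^sub>R (M + N) + ((a - b) / 2) *\<^sub>R (M - N)"
      by (simp add: vec_eq_iff field_simps)
    then show "\<exists>x y. V = x *\<^sub>R (M + N) + y *\<^sub>R (M - N)" by blast
  qed
qed

text \<open>Two orthogonal null vectors of a Lorentzian plane are parallel, so a totally isotropic family of
  tangent vectors lies on one of the two null lines; as \<open>B + C\<close> is onto the plane, \<open>B\<close> and \<open>C\<close> take
  different ones.\<close>

lemma isotropic_summands_span_null_lines:
  fixes B C :: "real \<times> real \<Rightarrow> real^4"
  assumes sig: "signature_1_1 T" and T: "T = range (\<lambda>a. B a + C a)"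
    and BT: "\<And>a. B a \<in> T" and CT: "\<And>a. C a \<in> T"
    and B: "\<And>a b. inner22 (B a) (B b) = 0" and C: "\<And>a b. inner22 (C a) (C b) = 0"
  obtains X Y where "X \<in> T" "Y \<in> T" "inner22 X X = 0" "inner22 Y Y = 0" "inner22 X Y \<noteq> 0"
    "\<And>a. \<exists>s. B a = s *\<^sub>R X" "\<And>a. \<exists>s. C a = s *\<^sub>R Y"
proof -
  obtain X Y where XT: "X \<in> T" and YT: "Y \<in> T"
    and XY: "inner22 X X = 0" "inner22 Y Y = 0" "inner22 X Y = 2"
    and mem: "\<And>V. V \<in> T \<Longrightarrow> \<exists>x y. V = x *\<^sub>R X + y *\<^sub>R Y"
    by (rule lorentzian_plane_null_basis[OF sig]) (rule that; assumption)
  have YX: "inner22 Y X = 2" using XY(3) by (simp add: inner22_commute)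
  have line: "(\<forall>a. \<exists>s. A a = s *\<^sub>R X) \<or> (\<forall>a. \<exists>s. A a = s *\<^sub>R Y)"
    if AT: "\<And>a. A a \<in> T" and iso: "\<And>a b. inner22 (A a) (A b) = 0" for A :: "real \<times> real \<Rightarrow> real^4"
  proof -
    obtain x y where A: "\<And>a. A a = x a *\<^sub>R X + y a *\<^sub>R Y" using mem[OF AT] by metis
    have prod: "x a * y b + y a * x b = 0" for a b
      using iso[of a b] unfolding A by (simp add: inner22_linear XY YX algebra_simps)
    show ?thesis
    proof (cases "\<forall>a. x a = 0")
      case True
      then show ?thesis using A by auto
    next
      case False
      then obtain a where "x a \<noteq> 0" by blast
      then have "y b = 0" for b using prod[of a a] prod[of a b] by auto
      then show ?thesis using A by auto
    qed
  qed
  \<comment> \<open>If both summands lay on one null line, the whole plane would be totally isotropic.\<close>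
  have not_both: "\<not> ((\<forall>a. \<exists>s. B a = s *\<^sub>R Z) \<and> (\<forall>a. \<exists>s. C a = s *\<^sub>R Z))"
    if Z: "inner22 Z Z = 0" for Z
  proof
    assume BC: "(\<forall>a. \<exists>s. B a = s *\<^sub>R Z) \<and> (\<forall>a. \<exists>s. C a = s *\<^sub>R Z)"
    have T_line: "\<exists>s. V = s *\<^sub>R Z" if V: "V \<in> T" for V
    proof -
      obtain a where "V = B a + C a" using V unfolding T by blast
      moreover obtain s t where "B a = s *\<^sub>R Z" "C a = t *\<^sub>R Z" using BC by blast
      ultimately have "V = (s + t) *\<^sub>R Z" by (simp add: scaleR_left_distrib)
      then show ?thesis by blast
    qed
    obtain s t where "X = s *\<^sub>R Z" "Y = t *\<^sub>R Z" using T_line[OF XT] T_line[OF YT] by blast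
    then have "inner22 X Y = 0" by (simp add: inner22_linear Z)
    then show False using XY by simp
  qed
  show thesis
  proof (cases "\<forall>a. \<exists>s. B a = s *\<^sub>R X")
    case True
    then have CY: "\<forall>a. \<exists>s. C a = s *\<^sub>R Y" using not_both[OF XY(1)] line[of C, OF CT C] by argo
    show ?thesis by (rule that[OF XT YT XY(1,2) _ spec[OF True] spec[OF CY]]) (simp add: XY)
  next
    case False
    then have BY: "\<forall>a. \<exists>s. B a = s *\<^sub>R Y" using line[of B, OF BT B] by argo
    then have CX: "\<forall>a. \<exists>s. C a = s *\<^sub>R X" using not_both[OF XY(2)] line[of C, OF CT C] by argo
    show ?thesis by (rule that[OF YT XT XY(2,1) _ spec[OF BY] spec[OF CX]]) (simp add: YX)
  qed
qed

text \<open>With a potential \<open>\<Phi>\<close> of the conjugate form, \<open>\<beta> = (\<Psi> + \<Phi>) / 2\<close> and \<open>\<theta> = (\<Psi> - \<Phi>) / 2\<close>. The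
  images of \<open>d\<beta>\<close> and \<open>d\<theta>\<close> are totally isotropic because
  \<open>\<langle>d\<Psi>(a) \<plusminus> d\<Phi>(a), d\<Psi>(b) \<plusminus> d\<Phi>(b)\<rangle>\<close> expands into two pairs of opposite terms.\<close>

lemma minimal_surface_splits:
  assumes "minimal_lorentzian_surface \<Psi> U" and "p \<in> U"
  obtains R \<beta> \<theta> where "open R" "p \<in> R" "R \<subseteq> U" "smooth_on \<beta> R" "smooth_on \<theta> R"
    "\<And>q. \<Psi> q = \<beta> q + \<theta> q"
    "\<And>q. q \<in> R \<Longrightarrow> \<exists>X\<in>tangent_space \<Psi> q. \<exists>Y\<in>tangent_space \<Psi> q.
      inner22 X X = 0 \<and> inner22 Y Y = 0 \<and> inner22 X Y \<noteq> 0 \<and>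
      (\<forall>a. \<exists>s. frechet_derivative \<beta> (at q) a = s *\<^sub>R X) \<and>
      (\<forall>a. \<exists>s. frechet_derivative \<theta> (at q) a = s *\<^sub>R Y)"
proof -
  have lor: "lorentzian_surface \<Psi> U" using assms by (simp add: minimal_lorentzian_surface_def)
  note surf = lorentzian_surfaceD[OF lor]
  obtain u v where uv: "p = (u, v)" by (cases p)
  obtain a b c d where R: "a < u" "u < b" "c < v" "v < d" "{a..b} \<times> {c..d} \<subseteq> U"
    using open_rectangle_in[OF surf(1), of u v] assms(2) uv by blast
  obtain \<Phi> where "\<And>q. q \<in> {a<..<b} \<times> {c<..<d} \<Longrightarrow>
      (\<Phi> has_derivative (\<lambda>(x, y). x *\<^sub>R conjugate_u \<Psi> q + y *\<^sub>R conjugate_v \<Psi> q)) (at q)"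
    using closed_form_has_potential[OF smooth_on_conjugate[OF lor] R(5) minimal_imp_conjugate_closed[OF assms(1)]]
    by blast
  moreover define R where "R = {a<..<b} \<times> {c<..<d}"
  ultimately have \<Phi>: "(\<Phi> has_derivative (\<lambda>(x, y). x *\<^sub>R conjugate_u \<Psi> q + y *\<^sub>R conjugate_v \<Psi> q)) (at q)"
    if "q \<in> R" for q using that by blast
  have "open R" unfolding R_def by (intro open_Times open_greaterThanLessThan)
  have "R \<subseteq> U" "p \<in> R" using R uv unfolding R_def by auto
  note smooth_\<Psi> = smooth_on_subset[OF surf(2) \<open>R \<subseteq> U\<close>]
  have smooth_\<Phi>: "smooth_on \<Phi> R"
  proof (rule smooth_on_from_derivative[OF \<open>open R\<close> \<Phi>])
    fix z :: "real \<times> real"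
    show "smooth_on (\<lambda>q. (\<lambda>(x, y). x *\<^sub>R conjugate_u \<Psi> q + y *\<^sub>R conjugate_v \<Psi> q) z) R"
      unfolding split_def
      by (intro smooth_on_add smooth_on_scaleR smooth_on_const \<open>open R\<close>
          smooth_on_subset[OF smooth_on_conjugate(1)[OF lor] \<open>R \<subseteq> U\<close>]
          smooth_on_subset[OF smooth_on_conjugate(2)[OF lor] \<open>R \<subseteq> U\<close>])
  qed
  define \<beta> \<theta> where "\<beta> = (\<lambda>q. (1 / 2) *\<^sub>R (\<Psi> q + \<Phi> q))" and "\<theta> = (\<lambda>q. (1 / 2) *\<^sub>R (\<Psi> q - \<Phi> q))"
  show thesis
  proof (rule that[OF \<open>open R\<close> \<open>p \<in> R\<close> \<open>R \<subseteq> U\<close>])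
    show "smooth_on \<beta> R" "smooth_on \<theta> R"
      unfolding \<beta>_def \<theta>_def
      by (intro smooth_on_scaleR smooth_on_const smooth_on_add smooth_on_diff smooth_\<Phi> smooth_\<Psi> \<open>open R\<close>)+
    show "\<Psi> q = \<beta> q + \<theta> q" for q
      by (simp add: \<beta>_def \<theta>_def scaleR_add_right[symmetric])
    fix q assume "q \<in> R"
    then have "q \<in> U" using \<open>R \<subseteq> U\<close> by blast
    define d\<Psi> d\<Phi> where "d\<Psi> = frechet_derivative \<Psi> (at q)"
      and "d\<Phi> = (\<lambda>(x, y). x *\<^sub>R conjugate_u \<Psi> q + y *\<^sub>R conjugate_v \<Psi> q)"
    have d\<beta>: "frechet_derivative \<beta> (at q) = (\<lambda>z. (1 / 2) *\<^sub>R (d\<Psi> z + d\<Phi> z))"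
      and d\<theta>: "frechet_derivative \<theta> (at q) = (\<lambda>z. (1 / 2) *\<^sub>R (d\<Psi> z - d\<Phi> z))"
      unfolding \<beta>_def \<theta>_def d\<Psi>_def d\<Phi>_def
      by (intro frechet_derivative_eqI has_derivative_scaleR_right has_derivative_add has_derivative_diff
          \<Phi>[OF \<open>q \<in> R\<close>] smooth_on_has_derivative[OF surf(2) \<open>q \<in> U\<close>])+
    have d\<Psi>_plane: "d\<Psi> (x, y) = x *\<^sub>R d\<Psi> (1, 0) + y *\<^sub>R d\<Psi> (0, 1)" for x y
      unfolding d\<Psi>_def by (rule linear_plane[OF surf(5)[OF \<open>q \<in> U\<close>]])
    note prods = conjugate_products[OF lor \<open>q \<in> U\<close>, folded d\<Psi>_def]
    note flip = inner22_commute[of "d\<Psi> (1, 0)" "conjugate_u \<Psi> q"] inner22_commute[of "d\<Psi> (1, 0)" "conjugate_v \<Psi> q"]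
      inner22_commute[of "d\<Psi> (0, 1)" "conjugate_u \<Psi> q"] inner22_commute[of "d\<Psi> (0, 1)" "conjugate_v \<Psi> q"]
      inner22_commute[of "conjugate_v \<Psi> q" "conjugate_u \<Psi> q"] inner22_commute[of "d\<Psi> (0, 1)" "d\<Psi> (1, 0)"]
    have skew: "inner22 (d\<Phi> z) (d\<Psi> w) = - inner22 (d\<Psi> z) (d\<Phi> w)"
      and anti: "inner22 (d\<Phi> z) (d\<Phi> w) = - inner22 (d\<Psi> z) (d\<Psi> w)" for z w
    proof -
      obtain x y x' y' where zw: "z = (x, y)" "w = (x', y')" by (cases z, cases w)
      show "inner22 (d\<Phi> z) (d\<Psi> w) = - inner22 (d\<Psi> z) (d\<Phi> w)"
        "inner22 (d\<Phi> z) (d\<Phi> w) = - inner22 (d\<Psi> z) (d\<Psi> w)"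
        unfolding zw d\<Psi>_plane[of x y] d\<Psi>_plane[of x' y'] d\<Phi>_def case_prod_conv inner22_linear
        by (simp_all add: prods flip algebra_simps)
    qed
    have T: "subspace (tangent_space \<Psi> q)"
      unfolding tangent_space_def by (intro linear_subspace_image surf(5) subspace_UNIV \<open>q \<in> U\<close>)
    have d\<Psi>_T: "d\<Psi> z \<in> tangent_space \<Psi> q" for z by (simp add: d\<Psi>_def tangent_space_def)
    have d\<Phi>_T: "d\<Phi> z \<in> tangent_space \<Psi> q" for z
      unfolding d\<Phi>_def split_def conjugate_u_def conjugate_v_def
      by (intro subspace_add subspace_diff subspace_scale T d\<Psi>_T[unfolded d\<Psi>_def])
    have range: "tangent_space \<Psi> q = range (\<lambda>z. (1 / 2) *\<^sub>R (d\<Psi> z + d\<Phi> z) + (1 / 2) *\<^sub>R (d\<Psi> z - d\<Phi> z))"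
      unfolding tangent_space_def d\<Psi>_def[symmetric]
      by (simp add: scaleR_add_right[symmetric])
    have T_half: "(1 / 2) *\<^sub>R (d\<Psi> z + d\<Phi> z) \<in> tangent_space \<Psi> q"
      "(1 / 2) *\<^sub>R (d\<Psi> z - d\<Phi> z) \<in> tangent_space \<Psi> q" for z
      by (intro subspace_add subspace_diff subspace_scale T d\<Psi>_T d\<Phi>_T)+
    have iso: "inner22 ((1 / 2) *\<^sub>R (d\<Psi> z + d\<Phi> z)) ((1 / 2) *\<^sub>R (d\<Psi> w + d\<Phi> w)) = 0"
      "inner22 ((1 / 2) *\<^sub>R (d\<Psi> z - d\<Phi> z)) ((1 / 2) *\<^sub>R (d\<Psi> w - d\<Phi> w)) = 0" for z w
      unfolding inner22_linear by (simp_all add: skew anti diff_divide_distrib)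
    obtain X Y where "X \<in> tangent_space \<Psi> q" "Y \<in> tangent_space \<Psi> q"
      "inner22 X X = 0" "inner22 Y Y = 0" "inner22 X Y \<noteq> 0"
      "\<And>z. \<exists>s. (1 / 2) *\<^sub>R (d\<Psi> z + d\<Phi> z) = s *\<^sub>R X" "\<And>z. \<exists>s. (1 / 2) *\<^sub>R (d\<Psi> z - d\<Phi> z) = s *\<^sub>R Y"
      using isotropic_summands_span_null_lines[where B = "\<lambda>z. (1 / 2) *\<^sub>R (d\<Psi> z + d\<Phi> z)"
          and C = "\<lambda>z. (1 / 2) *\<^sub>R (d\<Psi> z - d\<Phi> z)", OF surf(4)[OF \<open>q \<in> U\<close>] range T_half iso]
      by metis
    then show "\<exists>X\<in>tangent_space \<Psi> q. \<exists>Y\<in>tangent_space \<Psi> q.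
      inner22 X X = 0 \<and> inner22 Y Y = 0 \<and> inner22 X Y \<noteq> 0 \<and>
      (\<forall>a. \<exists>s. frechet_derivative \<beta> (at q) a = s *\<^sub>R X) \<and>
      (\<forall>a. \<exists>s. frechet_derivative \<theta> (at q) a = s *\<^sub>R Y)"
      unfolding d\<beta> d\<theta> by (intro bexI[of _ X] bexI[of _ Y] conjI allI)
  qed
qed


section \<open>Moving the null directions into general position\<close>

text \<open>A line in the plane meets the unit circle in at most two points. So each of the two lines
  \<open>c x\<^sub>1 - s x\<^sub>2 + x\<^sub>3 = 0\<close> and \<open>c y\<^sub>1 - s y\<^sub>2 + y\<^sub>3 = 0\<close> in the \<open>(c, s)\<close>-plane contains at most two of
  the five points \<open>(\<plusminus>1, 0)\<close>, \<open>(0, \<plusminus>1)\<close>, \<open>(3/5, 4/5)\<close>, and one of the five is left over.\<close>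

lemma circle_point_off_two_lines:
  fixes x\<^sub>1 x\<^sub>2 x\<^sub>3 y\<^sub>1 y\<^sub>2 y\<^sub>3 :: real
  assumes "x\<^sub>1 \<noteq> 0 \<or> x\<^sub>2 \<noteq> 0" and "y\<^sub>1 \<noteq> 0 \<or> y\<^sub>2 \<noteq> 0"
  shows "\<exists>c s. c\<^sup>2 + s\<^sup>2 = 1 \<and> c * x\<^sub>1 - s * x\<^sub>2 + x\<^sub>3 \<noteq> 0 \<and> c * y\<^sub>1 - s * y\<^sub>2 + y\<^sub>3 \<noteq> 0"
proof (rule ccontr)
  assume none: "\<not> ?thesis"
  have *: "c * x\<^sub>1 - s * x\<^sub>2 + x\<^sub>3 = 0 \<or> c * y\<^sub>1 - s * y\<^sub>2 + y\<^sub>3 = 0" if "c\<^sup>2 + s\<^sup>2 = 1" for c s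
    using that none by blast
  have "x\<^sub>1 + x\<^sub>3 = 0 \<or> y\<^sub>1 + y\<^sub>3 = 0" "- x\<^sub>1 + x\<^sub>3 = 0 \<or> - y\<^sub>1 + y\<^sub>3 = 0"
    "- x\<^sub>2 + x\<^sub>3 = 0 \<or> - y\<^sub>2 + y\<^sub>3 = 0" "x\<^sub>2 + x\<^sub>3 = 0 \<or> y\<^sub>2 + y\<^sub>3 = 0"
    "3 / 5 * x\<^sub>1 - 4 / 5 * x\<^sub>2 + x\<^sub>3 = 0 \<or> 3 / 5 * y\<^sub>1 - 4 / 5 * y\<^sub>2 + y\<^sub>3 = 0"
    using *[of 1 0] *[of "- 1" 0] *[of 0 1] *[of 0 "- 1"] *[of "3 / 5" "4 / 5"]
    by (simp_all add: power2_eq_square)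
  then show False using assms by argo
qed

text \<open>Under the rotation \<open>(V\<^sub>1, V\<^sub>2) \<mapsto> (c V\<^sub>1 - s V\<^sub>2, s V\<^sub>1 + c V\<^sub>2)\<close> the functional \<open>V\<^sub>1 + V\<^sub>3\<close>
  becomes \<open>c V\<^sub>1 - s V\<^sub>2 + V\<^sub>3\<close>, which must not vanish on either null line. A non-zero null vector has
  \<open>(V\<^sub>1, V\<^sub>2) \<noteq> (0, 0)\<close>, as \<open>V\<^sub>1\<^sup>2 + V\<^sub>2\<^sup>2 = V\<^sub>3\<^sup>2 + V\<^sub>4\<^sup>2\<close>.\<close>

lemma ex_isometry_null_directions_representable:
  assumes "signature_1_1 T"
  obtains A where "linear_isometry22 A"
    "\<And>V. V \<in> T \<Longrightarrow> V \<noteq> 0 \<Longrightarrow> inner22 V V = 0 \<Longrightarrow> A V $ 1 + A V $ 3 \<noteq> 0"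
proof -
  obtain X Y where XY: "inner22 X X = 0" "inner22 Y Y = 0" "inner22 X Y = 2"
    and mem: "\<And>V. V \<in> T \<Longrightarrow> \<exists>x y. V = x *\<^sub>R X + y *\<^sub>R Y"
    by (rule lorentzian_plane_null_basis[OF assms]) (rule that; assumption)
  have YX: "inner22 Y X = 2" using XY(3) by (simp add: inner22_commute)
  have null_zero: "V = 0" if null: "inner22 V V = 0" and "\<not> (V $ 1 \<noteq> 0 \<or> V $ 2 \<noteq> 0)" for V
  proof -
    from that have "V $ 1 = 0" "V $ 2 = 0" by auto
    then have "inner22 V V = - (V $ 3 * V $ 3 + V $ 4 * V $ 4)" by (simp add: inner22_def)
    then have "V $ 3 * V $ 3 + V $ 4 * V $ 4 = 0" using null by linarith
    then have "V $ 3 = 0 \<and> V $ 4 = 0" by (rule iffD1[OF sum_squares_eq_zero_iff])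
    with \<open>V $ 1 = 0\<close> \<open>V $ 2 = 0\<close> show ?thesis by (simp add: vec_eq_iff forall_4)
  qed
  have "X \<noteq> 0" "Y \<noteq> 0" using XY(3) by (auto simp: inner22_def)
  then obtain c s where cs: "c\<^sup>2 + s\<^sup>2 = 1" and X: "c * X $ 1 - s * X $ 2 + X $ 3 \<noteq> 0"
    and Y: "c * Y $ 1 - s * Y $ 2 + Y $ 3 \<noteq> 0"
    using circle_point_off_two_lines[of "X $ 1" "X $ 2" "Y $ 1" "Y $ 2" "X $ 3" "Y $ 3"]
      null_zero[OF XY(1)] null_zero[OF XY(2)] by metis
  define A :: "real^4 \<Rightarrow> real^4"
    where "A = (\<lambda>V. vector [c * V $ 1 - s * V $ 2, s * V $ 1 + c * V $ 2, V $ 3, V $ 4])"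
  have A: "A V $ 1 = c * V $ 1 - s * V $ 2" "A V $ 2 = s * V $ 1 + c * V $ 2" "A V $ 3 = V $ 3"
    "A V $ 4 = V $ 4" for V
    by (simp_all add: A_def vector_def)
  show thesis
  proof
    have "linear A" by (rule linearI) (simp_all add: vec_eq_iff forall_4 A algebra_simps)
    moreover have "inner22 (A V) (A V') = inner22 V V'" for V V'
    proof -
      have "inner22 (A V) (A V') = (c\<^sup>2 + s\<^sup>2) * (V $ 1 * V' $ 1 + V $ 2 * V' $ 2)
          - V $ 3 * V' $ 3 - V $ 4 * V' $ 4"
        by (simp add: inner22_def A power2_eq_square algebra_simps)
      then show ?thesis by (simp add: cs inner22_def)
    qed
    ultimately show "linear_isometry22 A" by (simp add: linear_isometry22_def)
    fix V assume "V \<in> T" "V \<noteq> 0" and null: "inner22 V V = 0"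
    obtain x y where V: "V = x *\<^sub>R X + y *\<^sub>R Y" using mem[OF \<open>V \<in> T\<close>] by blast
    have "x * y = 0" using null unfolding V by (simp add: inner22_linear XY YX)
    moreover have "A V $ 1 + A V $ 3 =
        x * (c * X $ 1 - s * X $ 2 + X $ 3) + y * (c * Y $ 1 - s * Y $ 2 + Y $ 3)"
      by (simp add: A V algebra_simps)
    ultimately show "A V $ 1 + A V $ 3 \<noteq> 0" using X Y \<open>V \<noteq> 0\<close> V by auto
  qed
qed


section \<open>The Weierstrass type representation\<close>

lemma vector_derivative_eq_frechet_derivative:
  assumes "smooth_on \<beta> I" and "t \<in> I"
  shows "vector_derivative \<beta> (at t) = frechet_derivative \<beta> (at t) 1"
proof (rule vector_derivative_at)
  note der = smooth_on_has_derivative[OF assms]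
  have "frechet_derivative \<beta> (at t) h = h *\<^sub>R frechet_derivative \<beta> (at t) 1" for h
    using linear_cmul[OF has_derivative_linear[OF der], of h 1] by simp
  then show "(\<beta> has_vector_derivative frechet_derivative \<beta> (at t) 1) (at t)"
    unfolding has_vector_derivative_def by (rule has_derivative_eq_rhs[OF der, OF ext])
qed

text \<open>With the parameter normalized so that \<open>\<beta>'\<^sub>1 + \<beta>'\<^sub>3 = 1\<close>, the null condition
  \<open>(\<beta>'\<^sub>1 + \<beta>'\<^sub>3) (\<beta>'\<^sub>1 - \<beta>'\<^sub>3) = (\<beta>'\<^sub>4 + \<beta>'\<^sub>2) (\<beta>'\<^sub>4 - \<beta>'\<^sub>2)\<close> says that \<open>f = 1/2\<close> and the two factors on
  the right, as \<open>g\<close> and \<open>h\<close>, represent \<open>\<beta>'\<close>.\<close>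

lemma weierstrass_null_curve_of_normalized:
  assumes "null_curve \<beta> I"
    and norm: "\<And>t. t \<in> I \<Longrightarrow> vector_derivative \<beta> (at t) $ 1 + vector_derivative \<beta> (at t) $ 3 = 1"
  shows "weierstrass_null_curve \<beta> I"
proof -
  let ?d = "\<lambda>t. vector_derivative \<beta> (at t)"
  have I: "open I" and \<beta>: "smooth_on \<beta> I" and null: "\<And>t. t \<in> I \<Longrightarrow> inner22 (?d t) (?d t) = 0"
    using assms(1) by (auto simp: null_curve_def)
  have d: "smooth_on ?d I"
    by (rule smooth_on_cong[OF I _ smooth_on_frechet_derivative[OF \<beta>, of 1]])
      (simp add: vector_derivative_eq_frechet_derivative[OF \<beta>])
  have comp: "smooth_on (\<lambda>t. ?d t $ i) I" for i
    by (rule smooth_on_bounded_linear[OF bounded_linear_vec_nth I d])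
  define g h where "g = (\<lambda>t. ?d t $ 4 + ?d t $ 2)" and "h = (\<lambda>t. ?d t $ 4 - ?d t $ 2)"
  have "smooth_on g I" "smooth_on h I"
    unfolding g_def h_def by (intro smooth_on_add smooth_on_diff comp I)+
  moreover have "?d t = weierstrass_vector (1 / 2) (g t) (h t)" if "t \<in> I" for t
  proof -
    have "(?d t $ 1 + ?d t $ 3) * (?d t $ 1 - ?d t $ 3) = g t * h t"
      using null[OF that] by (simp add: g_def h_def inner22_def algebra_simps)
    then have gh: "?d t $ 1 - ?d t $ 3 = g t * h t" using norm[OF that] by simp
    show ?thesis
      unfolding vec_eq_iff forall_4 weierstrass_vector_nth gh[symmetric]
      using norm[OF that] by (simp add: g_def h_def)
  qed
  ultimately show ?thesis
    unfolding weierstrass_null_curve_def using assms(1) smooth_on_const[of "1 / 2" I] by blast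
qed

text \<open>The inverse of the new parametrization is \<open>\<xi>\<close> followed by half the sum and half the difference of the
  two coordinates.\<close>

lemma change_of_parameters_characteristic:
  assumes "open V" and "open U'" and hom: "homeomorphism U' V \<xi> g"
    and g: "smooth_on g V" and \<xi>: "smooth_on \<xi> U'"
    and IJ: "I \<times> J \<subseteq> V" "open I" "open J"
  shows "change_of_parameters (\<lambda>(u, v). g (u + v, u - v)) {(u, v). u + v \<in> I \<and> u - v \<in> J} (g ` (I \<times> J))"
proof -
  define W where "W = {(u, v). u + v \<in> I \<and> u - v \<in> (J :: real set)}"
  define \<phi> where "\<phi> = (\<lambda>(u, v). g (u + v, u - v))"
  define \<psi> where "\<psi> = (\<lambda>q. ((fst (\<xi> q) + snd (\<xi> q)) / 2, (fst (\<xi> q) - snd (\<xi> q)) / 2))"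
  define N where "N = g ` (I \<times> J)"
  have inv: "\<xi> (g y) = y" "g y \<in> U'" if "y \<in> I \<times> J" for y
    using hom that IJ(1) by (auto simp: homeomorphism_def)
  have W_eq: "W = (\<lambda>q. (fst q + snd q, fst q - snd q)) -` (I \<times> J)" by (auto simp: W_def)
  have "open W" unfolding W_eq by (intro open_vimage open_Times IJ continuous_intros)
  have "N = U' \<inter> \<xi> -` (I \<times> J)"
  proof (intro equalityI subsetI)
    fix q assume "q \<in> U' \<inter> \<xi> -` (I \<times> J)"
    then have "q = g (\<xi> q)" "\<xi> q \<in> I \<times> J" using hom by (auto simp: homeomorphism_def)
    then show "q \<in> N" unfolding N_def by (rule image_eqI)
  qed (use inv in \<open>auto simp: N_def\<close>)
  then have "open N"
    using continuous_open_preimage[OF smooth_on_continuous_on[OF \<xi>] \<open>open U'\<close> open_Times[OF IJ(2,3)]] by simp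
  have \<psi>: "\<psi> (g (u + v, u - v)) = (u, v)" if "(u, v) \<in> W" for u v
    using inv(1)[of "(u + v, u - v)"] that by (simp add: \<psi>_def W_def)
  have bij: "bij_betw \<phi> W N"
  proof (rule bij_betw_byWitness[where f' = \<psi>])
    show "\<forall>w\<in>W. \<psi> (\<phi> w) = w" using \<psi> by (auto simp: \<phi>_def)
    have sum: "(s + t) / 2 + (s - t) / 2 = s" "(s + t) / 2 - (s - t) / 2 = t" for s t :: real
      by (simp_all add: field_simps)
    show "\<forall>q\<in>N. \<phi> (\<psi> q) = q" using inv by (auto simp: N_def \<phi>_def \<psi>_def sum)
    show "\<phi> ` W \<subseteq> N" by (auto simp: \<phi>_def W_def N_def)
    show "\<psi> ` N \<subseteq> W" using inv by (auto simp: N_def W_def \<psi>_def sum)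
  qed
  have lin: "bounded_linear (\<lambda>q. (fst q + snd q, fst q - snd q :: real))"
    by (intro bounded_linear_Pair bounded_linear_add bounded_linear_sub bounded_linear_fst bounded_linear_snd)
  have "smooth_on (\<lambda>q. g (fst q + snd q, fst q - snd q)) W"
    by (rule smooth_on_compose[OF \<open>open W\<close> g smooth_on_bounded_linear[OF lin \<open>open W\<close> smooth_on_id[OF \<open>open W\<close>]]])
      (use IJ in \<open>auto simp: W_def\<close>)
  then have "smooth_on \<phi> W" by (simp add: \<phi>_def split_def)
  have "N \<subseteq> U'" using inv by (auto simp: N_def)
  note \<xi>N = smooth_on_subset[OF \<xi> this]
  have "smooth_on \<psi> N"
    unfolding \<psi>_def
    by (intro smooth_on_Pair smooth_on_divide smooth_on_add smooth_on_diff smooth_on_const \<open>open N\<close>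
        smooth_on_bounded_linear[OF bounded_linear_fst _ \<xi>N] smooth_on_bounded_linear[OF bounded_linear_snd _ \<xi>N]) simp_all
  moreover have "\<psi> q = inv_into W \<phi> q" if q: "q \<in> N" for q
  proof -
    obtain w where w: "w \<in> W" "q = \<phi> w" using bij q by (auto simp: bij_betw_def)
    then have "\<psi> q = w" using \<psi> by (cases w) (simp add: \<phi>_def)
    then show ?thesis using bij_betw_inv_into_left[OF bij w(1)] w(2) by simp
  qed
  ultimately have "smooth_on (inv_into W \<phi>) N" by (rule smooth_on_cong[OF \<open>open N\<close>, rotated])
  with \<open>open W\<close> \<open>open N\<close> bij \<open>smooth_on \<phi> W\<close> show ?thesis
    unfolding change_of_parameters_def W_def N_def \<phi>_def by blast
qed

text \<open>The coordinates are \<open>\<kappa> \<circ> \<beta>\<close> and \<open>\<kappa> \<circ> \<theta>\<close>, with inverse \<open>g\<close>. A direction in which the first of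
  them is constant is mapped by \<open>d\<beta>\<close> to a multiple of \<open>X\<close> on which \<open>\<kappa>\<close> vanishes; since \<open>d\<beta>\<close> attains a
  value with \<open>\<kappa> = 1\<close>, \<open>\<kappa> X \<noteq> 0\<close> and this multiple is zero. So \<open>\<beta> \<circ> g\<close> has zero derivative in the
  second coordinate, and \<open>\<theta> \<circ> g\<close> in the first.\<close>

lemma null_coordinates:
  fixes \<beta> \<theta> :: "real \<times> real \<Rightarrow> real^4" and \<kappa> :: "real^4 \<Rightarrow> real"
  assumes "open R" and "p \<in> R" and \<beta>: "smooth_on \<beta> R" and \<theta>: "smooth_on \<theta> R"
    and lin: "bounded_linear \<kappa>"
    and lines: "\<And>q. q \<in> R \<Longrightarrow> \<exists>X Y. inner22 X X = 0 \<and> inner22 Y Y = 0 \<and> inner22 X Y \<noteq> 0 \<and>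
      (\<forall>a. \<exists>s. frechet_derivative \<beta> (at q) a = s *\<^sub>R X) \<and>
      (\<forall>a. \<exists>s. frechet_derivative \<theta> (at q) a = s *\<^sub>R Y)"
    and inj: "inj (\<lambda>a. (\<kappa> (frechet_derivative \<beta> (at p) a), \<kappa> (frechet_derivative \<theta> (at p) a)))"
  obtains U' V g where "open U'" "U' \<subseteq> R" "p \<in> U'" "open V"
    "homeomorphism U' V (\<lambda>q. (\<kappa> (\<beta> q), \<kappa> (\<theta> q))) g" "smooth_on g V"
    "\<And>y. y \<in> V \<Longrightarrow> \<exists>B C. ((\<lambda>y. \<beta> (g y)) has_derivative (\<lambda>w. fst w *\<^sub>R B)) (at y) \<and>
      ((\<lambda>y. \<theta> (g y)) has_derivative (\<lambda>w. snd w *\<^sub>R C)) (at y) \<and>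
      inner22 B B = 0 \<and> inner22 C C = 0 \<and> inner22 B C \<noteq> 0 \<and> \<kappa> B = 1 \<and> \<kappa> C = 1"
proof -
  define \<xi> where "\<xi> = (\<lambda>q. (\<kappa> (\<beta> q), \<kappa> (\<theta> q)))"
  have \<xi>: "smooth_on \<xi> R"
    unfolding \<xi>_def by (intro smooth_on_Pair smooth_on_bounded_linear[OF lin] \<beta> \<theta> \<open>open R\<close>)
  have d\<xi>: "(\<xi> has_derivative (\<lambda>a. (\<kappa> (frechet_derivative \<beta> (at q) a), \<kappa> (frechet_derivative \<theta> (at q) a)))) (at q)"
    if "q \<in> R" for q
    unfolding \<xi>_def
    by (intro has_derivative_Pair bounded_linear.has_derivative[OF lin]
        smooth_on_has_derivative[OF \<beta> that] smooth_on_has_derivative[OF \<theta> that])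
  have "inj (frechet_derivative \<xi> (at p))"
    using inj unfolding frechet_derivative_eqI[OF d\<xi>[OF \<open>p \<in> R\<close>]] .
  from smooth_inverse_function_plane[OF \<open>open R\<close> \<xi> \<open>p \<in> R\<close> this]
  obtain U' V g where U': "open U'" "U' \<subseteq> R" "p \<in> U'" "open V" "homeomorphism U' V \<xi> g" and g: "smooth_on g V"
    by metis
  show thesis
  proof (rule that[OF U'(1-4) U'(5)[unfolded \<xi>_def] g])
    fix y assume y: "y \<in> V"
    have gy: "g y \<in> R" and \<xi>g: "\<And>z. z \<in> V \<Longrightarrow> z = \<xi> (g z)"
      using U'(2,5) y by (auto simp: homeomorphism_def)
    define dg d\<beta> d\<theta> where "dg = frechet_derivative g (at y)" and "d\<beta> = frechet_derivative \<beta> (at (g y))"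
      and "d\<theta> = frechet_derivative \<theta> (at (g y))"
    note dg = smooth_on_has_derivative[OF g y, folded dg_def]
    have lin_dg: "dg (s, t) = s *\<^sub>R dg (1, 0) + t *\<^sub>R dg (0, 1)" for s t
      by (rule linear_plane[OF has_derivative_linear[OF dg]])
    have "((\<lambda>z. \<xi> (g z)) has_derivative (\<lambda>w. (\<kappa> (d\<beta> (dg w)), \<kappa> (d\<theta> (dg w))))) (at y)"
      using has_derivative_compose[OF dg d\<xi>[OF gy]] by (simp add: d\<beta>_def d\<theta>_def)
    moreover have "((\<lambda>z. \<xi> (g z)) has_derivative (\<lambda>w. w)) (at y)"
      by (rule has_derivative_transform_within_open[OF has_derivative_ident \<open>open V\<close> y \<xi>g])
    ultimately have "(\<lambda>w. (\<kappa> (d\<beta> (dg w)), \<kappa> (d\<theta> (dg w)))) = (\<lambda>w. w)"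
      by (rule has_derivative_unique)
    then have dual: "(\<kappa> (d\<beta> (dg w)), \<kappa> (d\<theta> (dg w))) = w" for w
      by (rule fun_cong)
    obtain X Y where XY: "inner22 X X = 0" "inner22 Y Y = 0" "inner22 X Y \<noteq> 0"
      and X: "\<And>a. \<exists>s. d\<beta> a = s *\<^sub>R X" and Y: "\<And>a. \<exists>s. d\<theta> a = s *\<^sub>R Y"
      using lines[OF gy] unfolding d\<beta>_def d\<theta>_def by blast
    obtain s where s: "d\<beta> (dg (1, 0)) = s *\<^sub>R X" using X by blast
    obtain s' where s': "d\<beta> (dg (0, 1)) = s' *\<^sub>R X" using X by blast
    obtain t where t: "d\<theta> (dg (0, 1)) = t *\<^sub>R Y" using Y by blast
    obtain t' where t': "d\<theta> (dg (1, 0)) = t' *\<^sub>R Y" using Y by blast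
    note scale = linear_cmul[OF bounded_linear.linear[OF lin]]
    have *: "s * \<kappa> X = 1" "t' * \<kappa> Y = 0" "s' * \<kappa> X = 0" "t * \<kappa> Y = 1"
      using dual[of "(1, 0)"] dual[of "(0, 1)"] by (simp_all add: s s' t t' scale)
    then have nz: "s \<noteq> 0" "t \<noteq> 0" "s' = 0" "t' = 0" by auto
    have d\<beta>g: "((\<lambda>y. \<beta> (g y)) has_derivative (\<lambda>w. d\<beta> (dg w))) (at y)"
      unfolding d\<beta>_def by (rule has_derivative_compose[OF dg smooth_on_has_derivative[OF \<beta> gy]])
    have d\<theta>g: "((\<lambda>y. \<theta> (g y)) has_derivative (\<lambda>w. d\<theta> (dg w))) (at y)"
      unfolding d\<theta>_def by (rule has_derivative_compose[OF dg smooth_on_has_derivative[OF \<theta> gy]])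
    have "d\<beta> (dg w) = fst w *\<^sub>R (s *\<^sub>R X)" "d\<theta> (dg w) = snd w *\<^sub>R (t *\<^sub>R Y)" for w
      using linear_plane[OF has_derivative_linear[OF d\<beta>g], of "fst w" "snd w"]
        linear_plane[OF has_derivative_linear[OF d\<theta>g], of "fst w" "snd w"]
      by (simp_all add: s s' t t' nz)
    then have "((\<lambda>y. \<beta> (g y)) has_derivative (\<lambda>w. fst w *\<^sub>R (s *\<^sub>R X))) (at y)"
      "((\<lambda>y. \<theta> (g y)) has_derivative (\<lambda>w. snd w *\<^sub>R (t *\<^sub>R Y))) (at y)"
      using d\<beta>g d\<theta>g by simp_all
    moreover have "inner22 (s *\<^sub>R X) (s *\<^sub>R X) = 0" "inner22 (t *\<^sub>R Y) (t *\<^sub>R Y) = 0" "inner22 (s *\<^sub>R X) (t *\<^sub>R Y) \<noteq> 0"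
      using XY nz by (simp_all add: inner22_linear)
    moreover have "\<kappa> (s *\<^sub>R X) = 1" "\<kappa> (t *\<^sub>R Y) = 1" using * by (simp_all add: scale)
    ultimately show "\<exists>B C. ((\<lambda>y. \<beta> (g y)) has_derivative (\<lambda>w. fst w *\<^sub>R B)) (at y) \<and>
      ((\<lambda>y. \<theta> (g y)) has_derivative (\<lambda>w. snd w *\<^sub>R C)) (at y) \<and>
      inner22 B B = 0 \<and> inner22 C C = 0 \<and> inner22 B C \<noteq> 0 \<and> \<kappa> B = 1 \<and> \<kappa> C = 1" by blast
  qed
qed

text \<open>For \<open>\<Phi>\<^sub>u = b' + h'\<close> and \<open>\<Phi>\<^sub>v = b' - h'\<close> with null vectors \<open>b'\<close>, \<open>h'\<close> the coefficients are
  \<open>E = 2 \<langle>b', h'\<rangle> = - G\<close> and \<open>F = 0\<close>.\<close>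

lemma isothermal_on_null_sum:
  assumes W: "open W" and rep: "\<And>u v. (u, v) \<in> W \<Longrightarrow> \<Phi> (u, v) = b (u + v) + h (u - v)"
    and b: "\<And>u v. (u, v) \<in> W \<Longrightarrow> (b has_vector_derivative b' (u + v)) (at (u + v)) \<and> inner22 (b' (u + v)) (b' (u + v)) = 0"
    and h: "\<And>u v. (u, v) \<in> W \<Longrightarrow> (h has_vector_derivative h' (u - v)) (at (u - v)) \<and> inner22 (h' (u - v)) (h' (u - v)) = 0"
  shows "isothermal_on \<Phi> W"
proof -
  have "coeff_E \<Phi> (u, v) = - coeff_G \<Phi> (u, v) \<and> coeff_F \<Phi> (u, v) = 0" if uv: "(u, v) \<in> W" for u v
  proof -
    have plus: "((\<lambda>q. fst q + snd q :: real) has_derivative (\<lambda>a. fst a + snd a)) (at (u, v))"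
      and minus: "((\<lambda>q. fst q - snd q :: real) has_derivative (\<lambda>a. fst a - snd a)) (at (u, v))"
      by (auto intro!: derivative_eq_intros)
    have "((\<lambda>q. b (fst q + snd q) + h (fst q - snd q)) has_derivative
        (\<lambda>a. (fst a + snd a) *\<^sub>R b' (u + v) + (fst a - snd a) *\<^sub>R h' (u - v))) (at (u, v))"
      by (intro has_derivative_add has_derivative_compose[OF plus] has_derivative_compose[OF minus])
        (use b[OF uv] h[OF uv] in \<open>simp_all add: has_vector_derivative_def\<close>)
    then have "(\<Phi> has_derivative
        (\<lambda>a. (fst a + snd a) *\<^sub>R b' (u + v) + (fst a - snd a) *\<^sub>R h' (u - v))) (at (u, v))"
      by (rule has_derivative_transform_within_open[OF _ W uv]) (auto simp: rep)
    note d = frechet_derivative_eqI[OF this]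
    show ?thesis
      using b[OF uv] h[OF uv] unfolding coeff_E_def coeff_F_def coeff_G_def d
      by (simp add: inner22_linear inner22_commute[of "h' (u - v)" "b' (u + v)"])
  qed
  then show ?thesis by (auto simp: isothermal_on_def)
qed

text \<open>The hypothesis on \<open>A\<close> makes \<open>\<kappa>(X) = (A X)\<^sub>1 + (A X)\<^sub>3\<close> non-zero on both null lines at \<open>p\<close>, so that
  \<open>\<kappa>\<close> yields null coordinates, here called \<open>\<xi>\<close>. On a rectangle \<open>I \<times> J\<close> of coordinate values, \<open>\<beta>\<close> and
  \<open>\<theta>\<close> restricted to the coordinate lines through \<open>p\<close> and followed by \<open>A\<close> are the two null curves, already
  normalized by the choice of coordinates.\<close>

lemma weierstrass_representation_near_if_general_position:
  assumes min: "minimal_lorentzian_surface \<Psi> U" and "p \<in> U" and A: "linear_isometry22 A"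
    and general: "\<And>V. V \<in> tangent_space \<Psi> p \<Longrightarrow> V \<noteq> 0 \<Longrightarrow> inner22 V V = 0 \<Longrightarrow> A V $ 1 + A V $ 3 \<noteq> 0"
  shows "weierstrass_representation_near (A \<circ> \<Psi>) U p"
proof -
  have lor: "lorentzian_surface \<Psi> U" using min by (simp add: minimal_lorentzian_surface_def)
  note surf = lorentzian_surfaceD[OF lor]
  have blA: "bounded_linear A" and isoA: "\<And>X Y. inner22 (A X) (A Y) = inner22 X Y"
    using A by (auto simp: linear_isometry22_def linear_conv_bounded_linear)
  define \<kappa> where "\<kappa> = (\<lambda>X. A X $ 1 + A X $ 3)"
  have bl: "bounded_linear \<kappa>"
    unfolding \<kappa>_def
    by (intro bounded_linear_add bounded_linear_compose[OF bounded_linear_vec_nth blA])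
  obtain R \<beta> \<theta> where R: "open R" "p \<in> R" "R \<subseteq> U" and \<beta>: "smooth_on \<beta> R" and \<theta>: "smooth_on \<theta> R"
    and \<Psi>: "\<And>q. \<Psi> q = \<beta> q + \<theta> q"
    and lines: "\<And>q. q \<in> R \<Longrightarrow> \<exists>X\<in>tangent_space \<Psi> q. \<exists>Y\<in>tangent_space \<Psi> q.
      inner22 X X = 0 \<and> inner22 Y Y = 0 \<and> inner22 X Y \<noteq> 0 \<and>
      (\<forall>a. \<exists>s. frechet_derivative \<beta> (at q) a = s *\<^sub>R X) \<and>
      (\<forall>a. \<exists>s. frechet_derivative \<theta> (at q) a = s *\<^sub>R Y)"
    by (rule minimal_surface_splits[OF min \<open>p \<in> U\<close>]) (rule that; assumption)
  define d\<beta> d\<theta> where "d\<beta> = frechet_derivative \<beta> (at p)" and "d\<theta> = frechet_derivative \<theta> (at p)"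
  note der = smooth_on_has_derivative[OF \<beta> R(2), folded d\<beta>_def] smooth_on_has_derivative[OF \<theta> R(2), folded d\<theta>_def]
  have "inj (\<lambda>a. (\<kappa> (d\<beta> a), \<kappa> (d\<theta> a)))"
  proof -
    have lin: "linear (\<lambda>a. (\<kappa> (d\<beta> a), \<kappa> (d\<theta> a)))"
      by (intro bounded_linear.linear bounded_linear_Pair bounded_linear_compose[OF bl]
          has_derivative_bounded_linear[OF der(1)] has_derivative_bounded_linear[OF der(2)])
    have "a = 0" if a: "(\<kappa> (d\<beta> a), \<kappa> (d\<theta> a)) = 0" for a
    proof -
      obtain X Y where T: "X \<in> tangent_space \<Psi> p" "Y \<in> tangent_space \<Psi> p"
        and XY: "inner22 X X = 0" "inner22 Y Y = 0" "inner22 X Y \<noteq> 0"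
        and X: "\<exists>s. d\<beta> a = s *\<^sub>R X" and Y: "\<exists>s. d\<theta> a = s *\<^sub>R Y"
        using lines[OF R(2)] unfolding d\<beta>_def d\<theta>_def by blast
      have "X \<noteq> 0" "Y \<noteq> 0" using XY(3) by (auto simp: inner22_def)
      then have "\<kappa> X \<noteq> 0" "\<kappa> Y \<noteq> 0" using general T XY by (simp_all add: \<kappa>_def)
      moreover obtain s t where st: "d\<beta> a = s *\<^sub>R X" "d\<theta> a = t *\<^sub>R Y" using X Y by blast
      ultimately have "s = 0" "t = 0"
        using a by (simp_all add: linear_cmul[OF bounded_linear.linear[OF bl]] zero_prod_def)
      moreover have "frechet_derivative \<Psi> (at p) = (\<lambda>a. d\<beta> a + d\<theta> a)"
        using has_derivative_add[OF der] by (intro frechet_derivative_eqI) (simp add: \<Psi>[abs_def])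
      ultimately have "frechet_derivative \<Psi> (at p) a = 0" by (simp add: st)
      then show "a = 0"
        using surf(3)[OF \<open>p \<in> U\<close>] linear_0[OF surf(5)[OF \<open>p \<in> U\<close>]] by (metis injD)
    qed
    then show ?thesis unfolding linear_injective_0[OF lin] by blast
  qed
  then have inj: "inj (\<lambda>a. (\<kappa> (frechet_derivative \<beta> (at p) a), \<kappa> (frechet_derivative \<theta> (at p) a)))"
    by (simp only: d\<beta>_def d\<theta>_def)
  have lines': "\<exists>X Y. inner22 X X = 0 \<and> inner22 Y Y = 0 \<and> inner22 X Y \<noteq> 0 \<and>
      (\<forall>a. \<exists>s. frechet_derivative \<beta> (at q) a = s *\<^sub>R X) \<and>
      (\<forall>a. \<exists>s. frechet_derivative \<theta> (at q) a = s *\<^sub>R Y)" if "q \<in> R" for q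
    using lines[OF that] by blast
  define \<xi> where "\<xi> = (\<lambda>q. (\<kappa> (\<beta> q), \<kappa> (\<theta> q)))"
  obtain U' V g where U': "open U'" "U' \<subseteq> R" "p \<in> U'" "open V" and hom: "homeomorphism U' V \<xi> g" and g: "smooth_on g V"
    and BC: "\<And>y. y \<in> V \<Longrightarrow> \<exists>B C. ((\<lambda>y. \<beta> (g y)) has_derivative (\<lambda>w. fst w *\<^sub>R B)) (at y) \<and>
      ((\<lambda>y. \<theta> (g y)) has_derivative (\<lambda>w. snd w *\<^sub>R C)) (at y) \<and>
      inner22 B B = 0 \<and> inner22 C C = 0 \<and> inner22 B C \<noteq> 0 \<and> \<kappa> B = 1 \<and> \<kappa> C = 1"
    unfolding \<xi>_def
    by (rule null_coordinates[OF R(1,2) \<beta> \<theta> bl lines' inj];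
        (assumption | (rule that[unfolded \<xi>_def]; assumption)))
  \<comment> \<open>The derivatives of \<open>\<beta>\<close> and \<open>\<theta>\<close> along their own coordinate are fields of null vectors.\<close>
  define B C where "B = (\<lambda>y. frechet_derivative (\<lambda>y. \<beta> (g y)) (at y) (1, 0))"
    and "C = (\<lambda>y. frechet_derivative (\<lambda>y. \<theta> (g y)) (at y) (0, 1))"
  have B: "((\<lambda>y. \<beta> (g y)) has_derivative (\<lambda>w. fst w *\<^sub>R B y)) (at y)"
    and C: "((\<lambda>y. \<theta> (g y)) has_derivative (\<lambda>w. snd w *\<^sub>R C y)) (at y)"
    and null: "inner22 (B y) (B y) = 0" "inner22 (C y) (C y) = 0" "inner22 (B y) (C y) \<noteq> 0"
    and norm: "\<kappa> (B y) = 1" "\<kappa> (C y) = 1" if y: "y \<in> V" for y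
  proof -
    obtain B\<^sub>0 C\<^sub>0 where B\<^sub>0: "((\<lambda>y. \<beta> (g y)) has_derivative (\<lambda>w. fst w *\<^sub>R B\<^sub>0)) (at y)"
      and C\<^sub>0: "((\<lambda>y. \<theta> (g y)) has_derivative (\<lambda>w. snd w *\<^sub>R C\<^sub>0)) (at y)"
      and props: "inner22 B\<^sub>0 B\<^sub>0 = 0" "inner22 C\<^sub>0 C\<^sub>0 = 0" "inner22 B\<^sub>0 C\<^sub>0 \<noteq> 0" "\<kappa> B\<^sub>0 = 1" "\<kappa> C\<^sub>0 = 1"
      using BC[OF y] by blast
    have "B y = B\<^sub>0" "C y = C\<^sub>0"
      unfolding B_def C_def frechet_derivative_eqI[OF B\<^sub>0] frechet_derivative_eqI[OF C\<^sub>0] by simp_all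
    then show "((\<lambda>y. \<beta> (g y)) has_derivative (\<lambda>w. fst w *\<^sub>R B y)) (at y)"
      "((\<lambda>y. \<theta> (g y)) has_derivative (\<lambda>w. snd w *\<^sub>R C y)) (at y)"
      "inner22 (B y) (B y) = 0" "inner22 (C y) (C y) = 0" "inner22 (B y) (C y) \<noteq> 0"
      "\<kappa> (B y) = 1" "\<kappa> (C y) = 1"
      using B\<^sub>0 C\<^sub>0 props by simp_all
  qed
  obtain t\<^sub>0 s\<^sub>0 where ts0: "\<xi> p = (t\<^sub>0, s\<^sub>0)" by (cases "\<xi> p")
  have "(t\<^sub>0, s\<^sub>0) \<in> V" and gp: "g (t\<^sub>0, s\<^sub>0) = p"
    unfolding ts0[symmetric] using hom \<open>p \<in> U'\<close> by (auto simp: homeomorphism_def)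
  obtain a b c d where rect: "a < t\<^sub>0" "t\<^sub>0 < b" "c < s\<^sub>0" "s\<^sub>0 < d" "{a..b} \<times> {c..d} \<subseteq> V"
    by (rule open_rectangle_in[OF \<open>open V\<close> \<open>(t\<^sub>0, s\<^sub>0) \<in> V\<close>])
  define I J where "I = {a<..<b}" and "J = {c<..<d}"
  have IJ: "open I" "open J" "I \<times> J \<subseteq> V" "t\<^sub>0 \<in> I" "s\<^sub>0 \<in> J" "convex I" "convex J"
    and intervals: "is_interval I" "is_interval J"
    using rect by (auto simp: I_def J_def is_interval_oo)
  have V: "(t, s) \<in> V" if "t \<in> I" "s \<in> J" for t s using IJ(3) that by auto
  have \<beta>_const: "\<beta> (g (t, s)) = \<beta> (g (t, s'))" if "t \<in> I" "s \<in> J" "s' \<in> J" for t s s'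
  proof -
    have "((\<lambda>s. \<beta> (g (t, s))) has_derivative (\<lambda>h. 0)) (at s within J)" if "s \<in> J" for s
      using has_vector_derivative_snd[OF B[OF V[OF \<open>t \<in> I\<close> that]]] by (simp add: has_vector_derivative_def)
    then obtain k where "\<And>s. s \<in> J \<Longrightarrow> \<beta> (g (t, s)) = k"
      using has_derivative_zero_constant[OF \<open>convex J\<close>] by blast
    then show ?thesis using that by simp
  qed
  have \<theta>_const: "\<theta> (g (t, s)) = \<theta> (g (t', s))" if "s \<in> J" "t \<in> I" "t' \<in> I" for t t' s
  proof -
    have "((\<lambda>t. \<theta> (g (t, s))) has_derivative (\<lambda>h. 0)) (at t within I)" if "t \<in> I" for t
      using has_vector_derivative_fst[OF C[OF V[OF that \<open>s \<in> J\<close>]]] by (simp add: has_vector_derivative_def)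
    then obtain k where "\<And>t. t \<in> I \<Longrightarrow> \<theta> (g (t, s)) = k"
      using has_derivative_zero_constant[OF \<open>convex I\<close>] by blast
    then show ?thesis using that by simp
  qed
  define \<beta>' \<theta>' where "\<beta>' = (\<lambda>t. A (\<beta> (g (t, s\<^sub>0))))" and "\<theta>' = (\<lambda>s. A (\<theta> (g (t\<^sub>0, s))))"
  have d\<beta>': "(\<beta>' has_vector_derivative A (B (t, s))) (at t)" if "t \<in> I" "s \<in> J" for t s
  proof (rule has_vector_derivative_transform_within_open[OF _ IJ(1) that(1)])
    show "((\<lambda>t. A (\<beta> (g (t, s)))) has_vector_derivative A (B (t, s))) (at t)"
      using bounded_linear.has_vector_derivative[OF blA has_vector_derivative_fst[OF B[OF V[OF that]]]] by simp
    show "A (\<beta> (g (x, s))) = \<beta>' x" if "x \<in> I" for x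
      using \<beta>_const[OF that \<open>s \<in> J\<close> IJ(5)] by (simp add: \<beta>'_def)
  qed
  have d\<theta>': "(\<theta>' has_vector_derivative A (C (t, s))) (at s)" if "t \<in> I" "s \<in> J" for t s
  proof (rule has_vector_derivative_transform_within_open[OF _ IJ(2) that(2)])
    show "((\<lambda>s. A (\<theta> (g (t, s)))) has_vector_derivative A (C (t, s))) (at s)"
      using bounded_linear.has_vector_derivative[OF blA has_vector_derivative_snd[OF C[OF V[OF that]]]] by simp
    show "A (\<theta> (g (t, x))) = \<theta>' x" if "x \<in> J" for x
      using \<theta>_const[OF that \<open>t \<in> I\<close> IJ(4)] by (simp add: \<theta>'_def)
  qed
  have gV: "g ` V \<subseteq> R" using hom U'(2) by (auto simp: homeomorphism_def)
  have smooth: "smooth_on \<beta>' I" "smooth_on \<theta>' J"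
    unfolding \<beta>'_def \<theta>'_def
    using V IJ(4,5) gV
    by (intro smooth_on_bounded_linear[OF blA] smooth_on_compose[OF _ \<beta>] smooth_on_compose[OF _ \<theta>]
        smooth_on_compose[OF _ g] smooth_on_Pair smooth_on_const smooth_on_id IJ; force)+
  have vd: "vector_derivative \<beta>' (at t) = A (B (t, s))" "vector_derivative \<theta>' (at s) = A (C (t, s))"
    if "t \<in> I" "s \<in> J" for t s
    using d\<beta>'[OF that] d\<theta>'[OF that] by (auto intro: vector_derivative_at)
  have normalized: "A (B y) $ 1 + A (B y) $ 3 = 1" "A (C y) $ 1 + A (C y) $ 3 = 1" if "y \<in> V" for y
    using norm[OF that] by (simp_all add: \<kappa>_def)
  have nz: "A (B y) \<noteq> 0" "A (C y) \<noteq> 0" if "y \<in> V" for y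
    using normalized[OF that] by auto
  have "null_curve \<beta>' I" "null_curve \<theta>' J"
    using IJ V intervals smooth nz null vd(1)[OF _ IJ(5)] vd(2)[OF IJ(4)]
    by (simp_all add: null_curve_def isoA)
  then have curves: "weierstrass_null_curve \<beta>' I" "weierstrass_null_curve \<theta>' J"
    using normalized V IJ(4,5) vd(1)[OF _ IJ(5)] vd(2)[OF IJ(4)]
    by (simp_all add: weierstrass_null_curve_of_normalized)
  define \<phi> where "\<phi> = (\<lambda>(u, v). g (u + v, u - v))"
  define W where "W = {(u, v). u + v \<in> I \<and> u - v \<in> J}"
  have change: "change_of_parameters \<phi> W (g ` (I \<times> J))"
    unfolding \<phi>_def W_def
  proof (rule change_of_parameters_characteristic[OF U'(4,1) hom g _ IJ(3,1,2)])
    show "smooth_on \<xi> U'"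
      unfolding \<xi>_def
      by (intro smooth_on_Pair smooth_on_bounded_linear[OF bl] U'(1) smooth_on_subset[OF \<beta> U'(2)]
          smooth_on_subset[OF \<theta> U'(2)])
  qed
  have rep: "((A \<circ> \<Psi>) \<circ> \<phi>) (u, v) = \<beta>' (u + v) + \<theta>' (u - v)" if "(u, v) \<in> W" for u v
  proof -
    have "u + v \<in> I" "u - v \<in> J" using that by (auto simp: W_def)
    then show ?thesis
      using \<beta>_const[of "u + v" "u - v" s\<^sub>0] \<theta>_const[of "u - v" "u + v" t\<^sub>0] IJ(4,5)
      by (simp add: \<phi>_def \<Psi> \<beta>'_def \<theta>'_def linear_add[OF bounded_linear.linear[OF blA]])
  qed
  have "open W" using change by (simp add: change_of_parameters_def)
  have "isothermal_on ((A \<circ> \<Psi>) \<circ> \<phi>) W"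
  proof (rule isothermal_on_null_sum[where b = \<beta>' and h = \<theta>' and b' = "\<lambda>t. A (B (t, s\<^sub>0))"
        and h' = "\<lambda>s. A (C (t\<^sub>0, s))", OF \<open>open W\<close> rep])
    fix u v assume "(u, v) \<in> W"
    then have "u + v \<in> I" "u - v \<in> J" by (auto simp: W_def)
    then show "(\<beta>' has_vector_derivative A (B (u + v, s\<^sub>0))) (at (u + v)) \<and>
        inner22 (A (B (u + v, s\<^sub>0))) (A (B (u + v, s\<^sub>0))) = 0"
      and "(\<theta>' has_vector_derivative A (C (t\<^sub>0, u - v))) (at (u - v)) \<and>
        inner22 (A (C (t\<^sub>0, u - v))) (A (C (t\<^sub>0, u - v))) = 0"
      using d\<beta>' d\<theta>' IJ(4,5) null V by (simp_all add: isoA)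
  qed
  moreover have "p \<in> g ` (I \<times> J)" using gp IJ(4,5) by (auto intro!: image_eqI[of _ g "(t\<^sub>0, s\<^sub>0)"])
  moreover have "g ` (I \<times> J) \<subseteq> U" using gV IJ(3) R(3) by blast
  moreover have "inner22 (vector_derivative \<beta>' (at t)) (vector_derivative \<theta>' (at s)) \<noteq> 0"
    if "t \<in> I" "s \<in> J" for t s
    using null(3)[OF V[OF that]] by (simp add: vd[OF that] isoA)
  ultimately have "let W = {(u, v). u + v \<in> I \<and> u - v \<in> J} in
        p \<in> g ` (I \<times> J) \<and> g ` (I \<times> J) \<subseteq> U \<and> change_of_parameters \<phi> W (g ` (I \<times> J)) \<and>
        isothermal_on ((A \<circ> \<Psi>) \<circ> \<phi>) W \<and> weierstrass_null_curve \<beta>' I \<and> weierstrass_null_curve \<theta>' J \<and>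
        (\<forall>t\<in>I. \<forall>s\<in>J. inner22 (vector_derivative \<beta>' (at t)) (vector_derivative \<theta>' (at s)) \<noteq> 0) \<and>
        (\<forall>(u, v)\<in>W. ((A \<circ> \<Psi>) \<circ> \<phi>) (u, v) = \<beta>' (u + v) + \<theta>' (u - v))"
    using change curves rep unfolding Let_def W_def[symmetric] by blast
  then show ?thesis
    unfolding weierstrass_representation_near_def by (intro exI)
qed

theorem theorem3p3:
  fixes \<Psi> :: "real \<times> real \<Rightarrow> real^4" and U :: "(real \<times> real) set"
  assumes "minimal_lorentzian_surface \<Psi> U"
    and "\<forall>p\<in>U. dim (first_normal_space \<Psi> p) = 2"
  shows "\<forall>p\<in>U. \<exists>A. linear_isometry22 A \<and>
           (null_directions_representable \<Psi> p \<longrightarrow> A = id) \<and>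
           weierstrass_representation_near (A \<circ> \<Psi>) U p"
proof
  fix p assume p: "p \<in> U"
  show "\<exists>A. linear_isometry22 A \<and> (null_directions_representable \<Psi> p \<longrightarrow> A = id) \<and>
           weierstrass_representation_near (A \<circ> \<Psi>) U p"
  proof (cases "null_directions_representable \<Psi> p")
    case True
    have id: "linear_isometry22 id" by (simp add: linear_isometry22_def linear_id)
    then have "weierstrass_representation_near (id \<circ> \<Psi>) U p"
      by (rule weierstrass_representation_near_if_general_position[OF assms(1) p])
        (use True in \<open>auto simp: null_directions_representable_def\<close>)
    with id show ?thesis by blast
  next
    case False
    have "signature_1_1 (tangent_space \<Psi> p)"
      using assms(1) p by (auto simp: minimal_lorentzian_surface_def lorentzian_surface_def)
    then obtain A where "linear_isometry22 A"
      "\<And>V. V \<in> tangent_space \<Psi> p \<Longrightarrow> V \<noteq> 0 \<Longrightarrow> inner22 V V = 0 \<Longrightarrow> A V $ 1 + A V $ 3 \<noteq> 0"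
      by (rule ex_isometry_null_directions_representable) (rule that; assumption)
    with weierstrass_representation_near_if_general_position[OF assms(1) p] False
    show ?thesis by blast
  qed
qed

end
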